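(* Let $X_1,X_2,\ldots$ be i.i.d. with density $s\in L^2([0,1])$ on $[0,1]$. For every $m\in\mathcal M_n$ and $p\in\{1,\ldots,n-1\}$, let $\mathrm{MSE}(m;p)=\big(\mathbb B[\widehat R_p(m)]\big)^2+\mathrm{Var}[\widehat R_p(m)]$, where $\widehat R_p(m)$ is the leave-$p$-out risk estimator of the projection estimator $\widehat s_m$ and $\mathbb B[\widehat R_p(m)]$ its bias. Consider the condition $$(\ast)\qquad 2\,\mathrm{Cov}\Big[\sum_{\lambda\in\Lambda(m)}\varphi_\lambda(X_1)\varphi_\lambda(X_2),\ \sum_{\lambda\in\Lambda(m)}\varphi_\lambda(X_1)\varphi_\lambda(X_3)\Big]\ \ge\ \mathrm{Cov}\Big[\sum_{\lambda\in\Lambda(m)}\varphi_\lambda^2(X_1),\ \sum_{\lambda\in\Lambda(m)}\varphi_\lambda(X_1)\varphi_\lambda(X_3)\Big].$$ 1. If $(\ast)$ holds true, then for every $m\in\mathcal M_n$ the map $p\in\{1,\ldots,n-1\}\mapsto \mathrm{MSE}(m;p)$ is minimum at $p=1$. 2. Otherwise, for every sequence $p=p_n\in\{1,\ldots,n-1\}$ such that $\limsup_{n\to+\infty}p_n/n<1$, $$\mathrm{MSE}(m;p)=\frac{A}{n}+O\Big(\frac1{n^2}\Big)\quad\text{as }n\to+\infty,$$ where $A=4\,\mathrm{Cov}\big[\sum_{\lambda\in\Lambda(m)}\varphi_\lambda(X_1)\varphi_\lambda(X_2),\sum_{\lambda\in\Lambda(m)}\varphi_\lambda(X_1)\varphi_\lambda(X_3)\big]$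 and the $O(\cdot)$ depends on $S_m$ and on the distribution $P$ (which are kept fixed as $n\to+\infty$).
   Context: $P$ is the distribution with density $s$ with respect to Lebesgue measure on $[0,1]$; $\|\cdot\|$ is the norm of $L^2([0,1])$. For every $m\in\mathcal M_n$ ($\mathcal M_n$ countable), $\{\varphi_\lambda\}_{\lambda\in\Lambda(m)}$ is a finite orthonormal family of real-valued measurable functions in $L^2([0,1])$ and $S_m$ is its linear span. The projection estimator based on $X_{1,n}=(X_1,\ldots,X_n)$ is $\widehat s_m=\sum_{\lambda\in\Lambda(m)}\big(\frac1n\sum_{i=1}^n\varphi_\lambda(X_i)\big)\varphi_\lambda$. For $e\subset\{1,\ldots,n\}$ with $\mathrm{Card}(e)=p$, $\widehat s_m(X^{(e)})=\sum_{\lambda\in\Lambda(m)}\big(\frac1{n-p}\sum_{i\notin e}\varphi_\lambda(X_i)\big)\varphi_\lambda$ is the same estimator computed from the observations with index not in $e$. With $\gamma(u;x)=\|u\|^2-2u(x)$ and $\mathcal E_p=\{e\subset\{1,\ldots,n\}:\mathrm{Card}(e)=p\}$, the leave-$p$-out risk estimator is $$\widehat R_p(m)=\binom np^{-1}\sum_{e\in\mathcal E_p}\frac1p\sum_{i\in e}\gamma\big(\widehat s_m(X^{(e)});X_i\big).$$ Its bias is $\mathbb B[\widehat R_p(m)]=\mathbb E[\widehat R_p(m)]-\mathbb E\big[\|\widehat s_m\|^2-2\int_{[0,1]}s\,\widehat s_m\big]$. The expectations, variances and covariances involved are assumed to be well defined and finite. *)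

theory Defs
  imports "HOL-Probability.Probability" "HOL-Library.Landau_Symbols"
begin

definition unit_lebesgue :: "real measure" where
  "unit_lebesgue = restrict_space lborel {0..1}"

definition L2_unit :: "(real \<Rightarrow> real) \<Rightarrow> bool" where
  "L2_unit u \<longleftrightarrow> u \<in> borel_measurable unit_lebesgue \<and> integrable unit_lebesgue (\<lambda>x. (u x)\<^sup>2)"

definition L2_inner :: "(real \<Rightarrow> real) \<Rightarrow> (real \<Rightarrow> real) \<Rightarrow> real" where
  "L2_inner u v = (LINT x|unit_lebesgue. u x * v x)"

definition L2_norm :: "(real \<Rightarrow> real) \<Rightarrow> real" where
  "L2_norm u = sqrt (L2_inner u u)"

definition orthonormal_family :: "'l set \<Rightarrow> ('l \<Rightarrow> real \<Rightarrow> real) \<Rightarrow> bool" where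
  "orthonormal_family L \<phi> \<longleftrightarrow>
     (\<forall>l\<in>L. L2_unit (\<phi> l)) \<and>
     (\<forall>l\<in>L. \<forall>k\<in>L. L2_inner (\<phi> l) (\<phi> k) = (if l = k then 1 else 0))"

definition cov :: "'a measure \<Rightarrow> ('a \<Rightarrow> real) \<Rightarrow> ('a \<Rightarrow> real) \<Rightarrow> real" where
  "cov \<Omega> Y Z = (LINT w|\<Omega>. (Y w - (LINT v|\<Omega>. Y v)) * (Z w - (LINT v|\<Omega>. Z v)))"

definition var :: "'a measure \<Rightarrow> ('a \<Rightarrow> real) \<Rightarrow> real" where
  "var \<Omega> Y = (LINT w|\<Omega>. (Y w - (LINT v|\<Omega>. Y v))\<^sup>2)"

text \<open>Integrals of non-integrable functions are 0 by convention, so the existence of variances and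
  covariances has to be required separately.\<close>

definition has_cov :: "'a measure \<Rightarrow> ('a \<Rightarrow> real) \<Rightarrow> ('a \<Rightarrow> real) \<Rightarrow> bool" where
  "has_cov \<Omega> Y Z \<longleftrightarrow> integrable \<Omega> Y \<and> integrable \<Omega> Z \<and>
     integrable \<Omega> (\<lambda>w. (Y w - (LINT v|\<Omega>. Y v)) * (Z w - (LINT v|\<Omega>. Z v)))"

definition has_var :: "'a measure \<Rightarrow> ('a \<Rightarrow> real) \<Rightarrow> bool" where
  "has_var \<Omega> Y \<longleftrightarrow> integrable \<Omega> Y \<and> integrable \<Omega> (\<lambda>w. (Y w - (LINT v|\<Omega>. Y v))\<^sup>2)"

text \<open>The index set \<open>I\<close> selects the observations used: \<open>{1..n}\<close> gives the estimator
  on the full sample, \<open>{1..n} - e\<close> the one computed without the observations in \<open>e\<close>.\<close>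

definition proj_est ::
    "'l set \<Rightarrow> ('l \<Rightarrow> real \<Rightarrow> real) \<Rightarrow> nat set \<Rightarrow> (nat \<Rightarrow> real) \<Rightarrow> real \<Rightarrow> real" where
  "proj_est L \<phi> I x = (\<lambda>t. \<Sum>l\<in>L. (1 / real (card I) * (\<Sum>i\<in>I. \<phi> l (x i))) * \<phi> l t)"

definition contrast :: "(real \<Rightarrow> real) \<Rightarrow> real \<Rightarrow> real" where
  "contrast u x = (L2_norm u)\<^sup>2 - 2 * u x"

definition lpo_risk ::
    "'l set \<Rightarrow> ('l \<Rightarrow> real \<Rightarrow> real) \<Rightarrow> nat \<Rightarrow> nat \<Rightarrow> (nat \<Rightarrow> real) \<Rightarrow> real" where
  "lpo_risk L \<phi> n p x =
     1 / real (n choose p) *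
       (\<Sum>e\<in>{e. e \<subseteq> {1..n} \<and> card e = p}.
          1 / real p * (\<Sum>i\<in>e. contrast (proj_est L \<phi> ({1..n} - e) x) (x i)))"

definition lpo_stat ::
    "(nat \<Rightarrow> 'a \<Rightarrow> real) \<Rightarrow> 'l set \<Rightarrow> ('l \<Rightarrow> real \<Rightarrow> real) \<Rightarrow> nat \<Rightarrow> nat \<Rightarrow> 'a \<Rightarrow> real" where
  "lpo_stat X L \<phi> n p w = lpo_risk L \<phi> n p (\<lambda>i. X i w)"

definition est_loss ::
    "(nat \<Rightarrow> 'a \<Rightarrow> real) \<Rightarrow> (real \<Rightarrow> real) \<Rightarrow> 'l set \<Rightarrow> ('l \<Rightarrow> real \<Rightarrow> real) \<Rightarrow> nat \<Rightarrow> 'a \<Rightarrow> real" where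
  "est_loss X s L \<phi> n w =
     (let u = proj_est L \<phi> {1..n} (\<lambda>i. X i w)
      in (L2_norm u)\<^sup>2 - 2 * (LINT t|unit_lebesgue. s t * u t))"

definition lpo_bias ::
    "'a measure \<Rightarrow> (nat \<Rightarrow> 'a \<Rightarrow> real) \<Rightarrow> (real \<Rightarrow> real) \<Rightarrow> 'l set \<Rightarrow> ('l \<Rightarrow> real \<Rightarrow> real) \<Rightarrow>
     nat \<Rightarrow> nat \<Rightarrow> real" where
  "lpo_bias \<Omega> X s L \<phi> n p =
     (LINT w|\<Omega>. lpo_stat X L \<phi> n p w) - (LINT w|\<Omega>. est_loss X s L \<phi> n w)"

definition lpo_MSE ::
    "'a measure \<Rightarrow> (nat \<Rightarrow> 'a \<Rightarrow> real) \<Rightarrow> (real \<Rightarrow> real) \<Rightarrow> 'l set \<Rightarrow> ('l \<Rightarrow> real \<Rightarrow> real) \<Rightarrow>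
     nat \<Rightarrow> nat \<Rightarrow> real" where
  "lpo_MSE \<Omega> X s L \<phi> n p = (lpo_bias \<Omega> X s L \<phi> n p)\<^sup>2 + var \<Omega> (lpo_stat X L \<phi> n p)"

definition cross ::
    "(nat \<Rightarrow> 'a \<Rightarrow> real) \<Rightarrow> 'l set \<Rightarrow> ('l \<Rightarrow> real \<Rightarrow> real) \<Rightarrow> nat \<Rightarrow> nat \<Rightarrow> 'a \<Rightarrow> real" where
  "cross X L \<phi> i j w = (\<Sum>l\<in>L. \<phi> l (X i w) * \<phi> l (X j w))"

definition sq_sum ::
    "(nat \<Rightarrow> 'a \<Rightarrow> real) \<Rightarrow> 'l set \<Rightarrow> ('l \<Rightarrow> real \<Rightarrow> real) \<Rightarrow> nat \<Rightarrow> 'a \<Rightarrow> real" where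
  "sq_sum X L \<phi> i w = (\<Sum>l\<in>L. (\<phi> l (X i w))\<^sup>2)"

definition cov_condition ::
    "'a measure \<Rightarrow> (nat \<Rightarrow> 'a \<Rightarrow> real) \<Rightarrow> 'l set \<Rightarrow> ('l \<Rightarrow> real \<Rightarrow> real) \<Rightarrow> bool" where
  "cov_condition \<Omega> X L \<phi> \<longleftrightarrow>
     2 * cov \<Omega> (cross X L \<phi> 1 2) (cross X L \<phi> 1 3)
       \<ge> cov \<Omega> (sq_sum X L \<phi> 1) (cross X L \<phi> 1 3)"

end

theory Submission
  imports Defs
begin

text \<open>
  Write \<open>V\<^sub>i\<close> for the vector \<open>(\<phi>\<^sub>l(X\<^sub>i))\<^sub>l\<close>. Averaging over all subsets of size \<open>p\<close> turns
  the leave-\<open>p\<close>-out estimator into an explicit statistic: with \<open>G\<close> the mean of the \<open>V\<^sub>i \<bullet> V\<^sub>i\<close>,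
  \<open>H\<close> the mean of the \<open>V\<^sub>i \<bullet> V\<^sub>j\<close> over \<open>i \<noteq> j\<close>, and \<open>t = 1 / (n - p)\<close>, it equals
  \<open>t * (G - H) - H\<close> (lemma \<open>lpo_risk_closed_form\<close>). So \<open>p\<close> enters through \<open>t\<close> alone, which
  increases with \<open>p\<close> and always exceeds \<open>1 / n\<close>.

  The kernel \<open>V\<^sub>i \<bullet> V\<^sub>j\<close> is split in the manner of Hoeffding. With \<open>a = E V\<^sub>1\<close>,
  \<open>V\<^sub>i \<bullet> V\<^sub>j = a \<bullet> a + u\<^sub>i + u\<^sub>j + z\<^sub>i\<^sub>j\<close>, where \<open>u\<^sub>i = a \<bullet> (V\<^sub>i - a)\<close> and
  \<open>z\<^sub>i\<^sub>j = (V\<^sub>i - a) \<bullet> (V\<^sub>j - a)\<close>. The \<open>z\<^sub>i\<^sub>j\<close> are orthogonal to every square integrable function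
  of one observation, and two of them are orthogonal unless they share both indices. Hence the
  variance of the estimator has no terms mixing the two kinds, and since
  \<open>Cov[V\<^sub>1 \<bullet> V\<^sub>2, V\<^sub>1 \<bullet> V\<^sub>3] = Var u\<^sub>1\<close> and \<open>Cov[V\<^sub>1 \<bullet> V\<^sub>1, V\<^sub>1 \<bullet> V\<^sub>3] = Cov[V\<^sub>1 \<bullet> V\<^sub>1, u\<^sub>1]\<close>,
  calling these two numbers \<open>C\<close> and \<open>K\<close> yields (lemma \<open>lpo_MSE_formula\<close>)
  \<open>MSE = 4 C / n + (t - 1/n)\<^sup>2 b\<^sup>2 + (t\<^sup>2 q + 4 t (2 C - K)) / n + (1 + t)\<^sup>2 * 2 d / (n (n - 1))\<close>
  with \<open>b\<close> the expectation of \<open>(V\<^sub>1 - a) \<bullet> (V\<^sub>1 - a)\<close> and with \<open>q, d \<ge> 0\<close>.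

  Both claims are read off this formula. The covariance condition is \<open>K \<le> 2 C\<close>; under it every
  summand is nondecreasing in \<open>t \<ge> 1/n\<close>, so the smallest \<open>t\<close>, that is \<open>p = 1\<close>, is optimal. If
  \<open>p/n\<close> stays away from \<open>1\<close> then \<open>t = O(1/n)\<close>, and every summand except \<open>4 C / n\<close> is
  \<open>O(1/n\<^sup>2)\<close>.

  All this needs \<open>V\<^sub>1 \<bullet> V\<^sub>1\<close> to be square integrable. This follows from the finite variances of the
  estimator for \<open>n = 3\<close>: \<open>G\<close> is a linear combination of the statistics for \<open>p = 1\<close> and \<open>p = 2\<close>, and
  it dominates \<open>V\<^sub>1 \<bullet> V\<^sub>1 / 3\<close> (lemma \<open>fourth_moment_from_lpo_variances\<close>).
\<close>

section \<open>Square integrable functions\<close>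

definition sq_integrable :: "'a measure \<Rightarrow> ('a \<Rightarrow> real) \<Rightarrow> bool" where
  "sq_integrable \<Omega> Y \<longleftrightarrow> Y \<in> borel_measurable \<Omega> \<and> integrable \<Omega> (\<lambda>w. (Y w)\<^sup>2)"

lemma abs_mult_le_sum_squares: "\<bar>a * b\<bar> \<le> a\<^sup>2 + b\<^sup>2" for a b :: real
proof -
  have "2 * (\<bar>a\<bar> * \<bar>b\<bar>) \<le> a\<^sup>2 + b\<^sup>2"
    using sum_squares_bound[of "\<bar>a\<bar>" "\<bar>b\<bar>"] by (simp add: mult.assoc)
  moreover have "0 \<le> \<bar>a\<bar> * \<bar>b\<bar>" by simp
  ultimately show ?thesis unfolding abs_mult by linarith
qed

lemma abs_add_four_le:
  fixes a b c d :: real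
  assumes "\<bar>a\<bar> \<le> a'" "\<bar>b\<bar> \<le> b'" "\<bar>c\<bar> \<le> c'" "\<bar>d\<bar> \<le> d'"
  shows "\<bar>a + b + c + d\<bar> \<le> a' + b' + c' + d'"
  using assms by linarith

lemma sq_integrable_mult:
  assumes "sq_integrable \<Omega> Y" "sq_integrable \<Omega> Z"
  shows "integrable \<Omega> (\<lambda>w. Y w * Z w)"
proof (rule Bochner_Integration.integrable_bound)
  show "integrable \<Omega> (\<lambda>w. (Y w)\<^sup>2 + (Z w)\<^sup>2)" "(\<lambda>w. Y w * Z w) \<in> borel_measurable \<Omega>"
    using assms by (auto simp: sq_integrable_def)
  show "AE w in \<Omega>. norm (Y w * Z w) \<le> norm ((Y w)\<^sup>2 + (Z w)\<^sup>2)"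
    using abs_mult_le_sum_squares by (auto intro!: AE_I2 order_trans[OF _ abs_ge_self])
qed

lemma sq_integrable_cmult:
  assumes "sq_integrable \<Omega> Y"
  shows "sq_integrable \<Omega> (\<lambda>w. c * Y w)"
  using assms by (auto simp: sq_integrable_def power_mult_distrib)

lemma sq_integrable_add:
  assumes "sq_integrable \<Omega> Y" "sq_integrable \<Omega> Z"
  shows "sq_integrable \<Omega> (\<lambda>w. Y w + Z w)"
proof -
  have "integrable \<Omega> (\<lambda>w. (Y w)\<^sup>2 + (Z w)\<^sup>2 + 2 * (Y w * Z w))"
    using assms sq_integrable_mult[OF assms] by (auto simp: sq_integrable_def)
  then show ?thesis
    using assms by (auto simp: sq_integrable_def power2_sum mult.assoc)
qed

lemma sq_integrable_diff:
  assumes "sq_integrable \<Omega> Y" "sq_integrable \<Omega> Z"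
  shows "sq_integrable \<Omega> (\<lambda>w. Y w - Z w)"
  using sq_integrable_add[OF assms(1) sq_integrable_cmult[OF assms(2), of "-1"]] by simp

lemma sq_integrable_sum:
  assumes "\<And>a. a \<in> A \<Longrightarrow> sq_integrable \<Omega> (Y a)"
  shows "sq_integrable \<Omega> (\<lambda>w. \<Sum>a\<in>A. Y a w)"
  using assms
proof (induction A rule: infinite_finite_induct)
  case (insert a A)
  then show ?case by (simp add: sq_integrable_add)
qed (auto simp: sq_integrable_def)

lemma sq_integrable_dominated:
  assumes "sq_integrable \<Omega> Z" "Y \<in> borel_measurable \<Omega>"
    and "\<And>w. w \<in> space \<Omega> \<Longrightarrow> \<bar>Y w\<bar> \<le> \<bar>Z w\<bar>"
  shows "sq_integrable \<Omega> Y"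
proof -
  have "integrable \<Omega> (\<lambda>w. (Y w)\<^sup>2)"
  proof (rule Bochner_Integration.integrable_bound)
    show "integrable \<Omega> (\<lambda>w. (Z w)\<^sup>2)" using assms(1) by (simp add: sq_integrable_def)
    show "AE w in \<Omega>. norm ((Y w)\<^sup>2) \<le> norm ((Z w)\<^sup>2)"
      using assms(3) by (intro AE_I2) (simp add: abs_le_square_iff)
  qed (use assms(2) in measurable)
  then show ?thesis using assms(2) by (simp add: sq_integrable_def)
qed

text \<open>Used to get products of two coordinates with finite fourth moments into \<open>L\<^sup>2\<close>.\<close>

lemma sq_integrable_mult_of_squares:
  assumes "Y \<in> borel_measurable \<Omega>" "Z \<in> borel_measurable \<Omega>"
    and "sq_integrable \<Omega> (\<lambda>w. (Y w)\<^sup>2)" "sq_integrable \<Omega> (\<lambda>w. (Z w)\<^sup>2)"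
  shows "sq_integrable \<Omega> (\<lambda>w. Y w * Z w)"
  using assms(1,2) sq_integrable_mult[OF assms(3,4)]
  by (simp add: sq_integrable_def power_mult_distrib)

lemma integral_sum_mult_sum:
  assumes "\<And>a. a \<in> A \<Longrightarrow> sq_integrable \<Omega> (Y a)" "\<And>b. b \<in> B \<Longrightarrow> sq_integrable \<Omega> (Z b)"
  shows "(LINT w|\<Omega>. (\<Sum>a\<in>A. Y a w) * (\<Sum>b\<in>B. Z b w)) = (\<Sum>a\<in>A. \<Sum>b\<in>B. LINT w|\<Omega>. Y a w * Z b w)"
  unfolding sum_product using assms
  by (subst Bochner_Integration.integral_sum,
      force intro!: Bochner_Integration.integrable_sum sq_integrable_mult)
     (intro sum.cong refl, subst Bochner_Integration.integral_sum, auto intro!: sq_integrable_mult)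

section \<open>Closed forms of the risk estimator and of the loss\<close>

text \<open>Removing \<open>B\<close> is a bijection onto the subsets of \<open>A - B - D\<close> of size \<open>p - card B\<close>.\<close>

lemma card_subsets_containing_avoiding:
  assumes "finite A" "B \<subseteq> A" "D \<subseteq> A" "B \<inter> D = {}" "card B \<le> p"
  shows "card {e. e \<subseteq> A \<and> card e = p \<and> B \<subseteq> e \<and> e \<inter> D = {}} =
           (card A - card B - card D) choose (p - card B)"
proof -
  have fB: "finite B" and fD: "finite D"
    using assms finite_subset by blast+
  have "bij_betw (\<lambda>e. e - B) {e. e \<subseteq> A \<and> card e = p \<and> B \<subseteq> e \<and> e \<inter> D = {}}
          {e. e \<subseteq> A - B - D \<and> card e = p - card B}"
  proof (rule bij_betwI[where g = "\<lambda>e. e \<union> B"])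
    show "(\<lambda>e. e - B) \<in> {e. e \<subseteq> A \<and> card e = p \<and> B \<subseteq> e \<and> e \<inter> D = {}} \<rightarrow>
            {e. e \<subseteq> A - B - D \<and> card e = p - card B}"
      using fB by (auto simp: card_Diff_subset)
    show "(\<lambda>e. e \<union> B) \<in> {e. e \<subseteq> A - B - D \<and> card e = p - card B} \<rightarrow>
            {e. e \<subseteq> A \<and> card e = p \<and> B \<subseteq> e \<and> e \<inter> D = {}}"
    proof
      fix e assume e: "e \<in> {e. e \<subseteq> A - B - D \<and> card e = p - card B}"
      then have "finite e" "e \<inter> B = {}"
        using assms(1) by (auto intro: finite_subset)
      with e assms fB show "e \<union> B \<in> {e. e \<subseteq> A \<and> card e = p \<and> B \<subseteq> e \<and> e \<inter> D = {}}"
        by (auto simp: card_Un_disjoint)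
    qed
  qed auto
  then have "card {e. e \<subseteq> A \<and> card e = p \<and> B \<subseteq> e \<and> e \<inter> D = {}} = card (A - B - D) choose (p - card B)"
    using assms(1) by (auto dest!: bij_betw_same_card simp: n_subsets)
  moreover have "card (A - B - D) = card A - card B - card D"
  proof -
    have "card (A - B - D) = card (A - B) - card D"
      using assms fD by (intro card_Diff_subset) auto
    then show ?thesis
      using assms fB by (simp add: card_Diff_subset)
  qed
  ultimately show ?thesis by simp
qed

text \<open>Exchanging the sums, each \<open>t\<close> is counted once for every \<open>e\<close> related to it. When \<open>E\<close>
  consists of all subsets of a given size, the number \<open>c\<close> of these exists by symmetry.\<close>

lemma sum_over_related:
  fixes f :: "'b \<Rightarrow> real"
  assumes "finite E" "finite T" "\<And>t. t \<in> T \<Longrightarrow> card {e \<in> E. R e t} = c"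
  shows "(\<Sum>e\<in>E. \<Sum>t\<in>{t \<in> T. R e t}. f t) = real c * (\<Sum>t\<in>T. f t)"
proof -
  have "(\<Sum>e\<in>E. \<Sum>t\<in>{t \<in> T. R e t}. f t) = (\<Sum>t\<in>T. \<Sum>e\<in>{e \<in> E. R e t}. f t)"
    by (rule sum.swap_restrict) (use assms in auto)
  also have "\<dots> = (\<Sum>t\<in>T. real c * f t)"
    using assms(3) by (intro sum.cong) auto
  finally show ?thesis
    by (simp add: sum_distrib_left)
qed

definition diag_mean ::
    "'l set \<Rightarrow> ('l \<Rightarrow> real \<Rightarrow> real) \<Rightarrow> nat \<Rightarrow> (nat \<Rightarrow> real) \<Rightarrow> real" where
  "diag_mean L \<phi> n x = (\<Sum>i\<in>{1..n}. \<Sum>l\<in>L. (\<phi> l (x i))\<^sup>2) / real n"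

definition ordered_pairs :: "nat \<Rightarrow> (nat \<times> nat) set" where
  "ordered_pairs n = {(i, j). i \<in> {1..n} \<and> j \<in> {1..n} \<and> i \<noteq> j}"

definition offdiag_mean ::
    "'l set \<Rightarrow> ('l \<Rightarrow> real \<Rightarrow> real) \<Rightarrow> nat \<Rightarrow> (nat \<Rightarrow> real) \<Rightarrow> real" where
  "offdiag_mean L \<phi> n x =
     (\<Sum>(i, j)\<in>ordered_pairs n. \<Sum>l\<in>L. \<phi> l (x i) * \<phi> l (x j)) / (real n * (real n - 1))"

lemma ordered_pairs_eq: "ordered_pairs n = (SIGMA i:{1..n}. {1..n} - {i})"
  by (auto simp: ordered_pairs_def)

lemma finite_ordered_pairs [simp, intro]: "finite (ordered_pairs n)"
  by (simp add: ordered_pairs_eq)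

lemma card_ordered_pairs: "1 \<le> n \<Longrightarrow> real (card (ordered_pairs n)) = real n * (real n - 1)"
  by (simp add: ordered_pairs_eq card_SigmaI of_nat_diff)

lemma sum_square_split_diagonal:
  fixes f :: "nat \<Rightarrow> real"
  assumes "I \<subseteq> {1..n}"
  shows "(\<Sum>i\<in>I. f i)\<^sup>2 =
           (\<Sum>i\<in>I. (f i)\<^sup>2) + (\<Sum>(i, j)\<in>{(i, j). (i, j) \<in> ordered_pairs n \<and> i \<in> I \<and> j \<in> I}. f i * f j)"
proof -
  have fin: "finite I"
    using assms finite_subset by blast
  have "{(i, j). (i, j) \<in> ordered_pairs n \<and> i \<in> I \<and> j \<in> I} = (SIGMA i:I. I - {i})"
    using assms by (auto simp: ordered_pairs_def)
  then have "(\<Sum>(i, j)\<in>{(i, j). (i, j) \<in> ordered_pairs n \<and> i \<in> I \<and> j \<in> I}. f i * f j)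
      = (\<Sum>i\<in>I. \<Sum>j\<in>I - {i}. f i * f j)"
    using fin by (simp add: sum.Sigma)
  moreover have "(\<Sum>i\<in>I. f i)\<^sup>2 = (\<Sum>i\<in>I. (f i)\<^sup>2 + (\<Sum>j\<in>I - {i}. f i * f j))"
    using fin by (simp add: power2_eq_square sum_product sum.remove)
  ultimately show ?thesis
    by (simp add: sum.distrib)
qed

lemma L2_unit_mult_integrable:
  assumes "L2_unit u" "L2_unit v"
  shows "integrable unit_lebesgue (\<lambda>x. u x * v x)"
  using assms by (intro sq_integrable_mult) (auto simp: L2_unit_def sq_integrable_def)

lemma L2_norm_combination:
  assumes "finite L" "orthonormal_family L \<phi>"
  shows "(L2_norm (\<lambda>t. \<Sum>l\<in>L. c l * \<phi> l t))\<^sup>2 = (\<Sum>l\<in>L. (c l)\<^sup>2)"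
proof -
  have int: "integrable unit_lebesgue (\<lambda>t. \<phi> l t * \<phi> k t)" if "l \<in> L" "k \<in> L" for l k
    using assms that by (intro L2_unit_mult_integrable) (auto simp: orthonormal_family_def)
  have "L2_inner (\<lambda>t. \<Sum>l\<in>L. c l * \<phi> l t) (\<lambda>t. \<Sum>l\<in>L. c l * \<phi> l t)
      = (LINT t|unit_lebesgue. (\<Sum>l\<in>L. \<Sum>k\<in>L. c l * c k * (\<phi> l t * \<phi> k t)))"
    unfolding L2_inner_def
    by (intro Bochner_Integration.integral_cong refl) (simp add: sum_product mult_ac)
  also have "\<dots> = (\<Sum>l\<in>L. \<Sum>k\<in>L. c l * c k * L2_inner (\<phi> l) (\<phi> k))"
    unfolding L2_inner_def using int
    by (subst Bochner_Integration.integral_sum,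
        force intro!: Bochner_Integration.integrable_sum integrable_mult_right)
       (intro sum.cong refl, subst Bochner_Integration.integral_sum,
        auto intro!: integrable_mult_right)
  also have "\<dots> = (\<Sum>l\<in>L. \<Sum>k\<in>L. if l = k then c l * c k else 0)"
    using assms(2) by (intro sum.cong refl) (auto simp: orthonormal_family_def)
  also have "\<dots> = (\<Sum>l\<in>L. (c l)\<^sup>2)"
    using assms(1) by (simp add: power2_eq_square)
  finally show ?thesis
    unfolding L2_norm_def by (simp add: sum_nonneg)
qed

text \<open>The probabilities that a uniformly random subset of size \<open>p\<close> misses a given point, misses two
  given points, and contains one given point while missing another one.\<close>

lemma binomial_ratios:
  fixes n p :: nat
  assumes "1 \<le> p" "p \<le> n - 1"
  shows "real ((n - 1) choose p) / real (n choose p) = (real n - real p) / real n"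
    and "real ((n - 2) choose p) / real (n choose p) =
           (real n - real p) * (real n - real p - 1) / (real n * (real n - 1))"
    and "real ((n - 2) choose (p - 1)) / real (n choose p) =
           real p * (real n - real p) / (real n * (real n - 1))"
proof -
  have n: "2 \<le> n" and pn: "p \<le> n" using assms by auto
  have pos: "0 < real (n choose p)" using pn by simp
  have n2: "n - 1 - 1 = n - 2" by simp
  have casts: "real (n - 1 - p) = real n - 1 - real p" "real (n - 1 - (p - 1)) = real n - real p" "real (n - 1) = real n - 1"
    using assms by linarith+
  have r1: "(real n - real p) * real (n choose p) = real n * real ((n - 1) choose p)"
    using arg_cong[OF binomial_absorb_comp[of n p], of real] pn by (simp add: of_nat_diff)
  have r2: "(real n - 1 - real p) * real ((n - 1) choose p) = (real n - 1) * real ((n - 2) choose p)"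
    using arg_cong[OF binomial_absorb_comp[of "n - 1" p], of real] unfolding n2 of_nat_mult casts .
  have r3: "real p * real (n choose p) = real n * real ((n - 1) choose (p - 1))"
    using arg_cong[OF times_binomial_minus1_eq[of p n], of real] assms by simp
  have r4: "(real n - real p) * real ((n - 1) choose (p - 1)) = (real n - 1) * real ((n - 2) choose (p - 1))"
    using arg_cong[OF binomial_absorb_comp[of "n - 1" "p - 1"], of real] unfolding n2 of_nat_mult casts .
  show "real ((n - 1) choose p) / real (n choose p) = (real n - real p) / real n"
    using r1 pos n by (simp add: field_simps)
  have "real n * (real n - 1) * real ((n - 2) choose p)
      = (real n - real p) * (real n - real p - 1) * real (n choose p)"
    using r1 r2 by algebra
  then show "real ((n - 2) choose p) / real (n choose p) =
           (real n - real p) * (real n - real p - 1) / (real n * (real n - 1))"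
    using pos n by (simp add: frac_eq_eq mult_ac)
  have "real n * (real n - 1) * real ((n - 2) choose (p - 1))
      = real p * (real n - real p) * real (n choose p)"
    using r3 r4 by algebra
  then show "real ((n - 2) choose (p - 1)) / real (n choose p) =
           real p * (real n - real p) / (real n * (real n - 1))"
    using pos n by (simp add: frac_eq_eq mult_ac)
qed

lemma L2_norm_proj_est:
  assumes "finite L" "orthonormal_family L \<phi>" "I \<subseteq> {1..n}"
  shows "(L2_norm (proj_est L \<phi> I x))\<^sup>2 =
    ((\<Sum>i\<in>I. \<Sum>l\<in>L. (\<phi> l (x i))\<^sup>2) +
     (\<Sum>(i, j)\<in>{(i, j). (i, j) \<in> ordered_pairs n \<and> i \<in> I \<and> j \<in> I}.
        \<Sum>l\<in>L. \<phi> l (x i) * \<phi> l (x j))) / (real (card I))\<^sup>2"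
proof -
  have "(L2_norm (proj_est L \<phi> I x))\<^sup>2 = (\<Sum>l\<in>L. (1 / real (card I) * (\<Sum>i\<in>I. \<phi> l (x i)))\<^sup>2)"
    unfolding proj_est_def by (rule L2_norm_combination[OF assms(1,2)])
  also have "\<dots> = (\<Sum>l\<in>L. (\<Sum>i\<in>I. \<phi> l (x i))\<^sup>2) / (real (card I))\<^sup>2"
    by (simp add: power_divide sum_divide_distrib[symmetric])
  also have "(\<Sum>l\<in>L. (\<Sum>i\<in>I. \<phi> l (x i))\<^sup>2) =
      (\<Sum>i\<in>I. \<Sum>l\<in>L. (\<phi> l (x i))\<^sup>2) +
     (\<Sum>(i, j)\<in>{(i, j). (i, j) \<in> ordered_pairs n \<and> i \<in> I \<and> j \<in> I}.
        \<Sum>l\<in>L. \<phi> l (x i) * \<phi> l (x j))"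
    by (simp add: sum_square_split_diagonal[OF assms(3)] sum.distrib split_def sum.swap[of _ _ L])
  finally show ?thesis .
qed

text \<open>For each \<open>e\<close>, the squared norm contributes a diagonal sum and an off-diagonal sum over the
  complement of \<open>e\<close>, while the evaluation at the points of \<open>e\<close> contributes a sum over pairs
  separated by \<open>e\<close>. By symmetry, averaging over \<open>e\<close> turns all of them into multiples of the full
  sums. With \<open>N = n - p\<close>, the off-diagonal mean receives the weight
  \<open>(N - 1) / N - 2 = - (1 + 1 / N)\<close>.\<close>

lemma lpo_risk_closed_form:
  assumes L: "finite L" "orthonormal_family L \<phi>" and p: "p \<in> {1..n - 1}"
  shows "lpo_risk L \<phi> n p x =
           1 / real (n - p) * (diag_mean L \<phi> n x - offdiag_mean L \<phi> n x) - offdiag_mean L \<phi> n x"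
proof -
  define E where "E = {e. e \<subseteq> {1..n} \<and> card e = p}"
  define N where "N = real n - real p"
  define g where "g i = (\<Sum>l\<in>L. (\<phi> l (x i))\<^sup>2)" for i
  define h where "h = (\<lambda>(i, j). \<Sum>l\<in>L. \<phi> l (x i) * \<phi> l (x j))"
  define T where "T = ordered_pairs n"
  have n: "2 \<le> n" "1 \<le> p" "p \<le> n - 1" and Npos: "0 < N" and ppos: "0 < real p"
    using p by (auto simp: N_def)
  have Npos': "real (n - p) = N" using n by (simp add: N_def of_nat_diff)
  have finE: "finite E" unfolding E_def by simp
  have finT: "finite T" by (simp add: T_def)
  have per_e: "1 / real p * (\<Sum>i\<in>e. contrast (proj_est L \<phi> ({1..n} - e) x) (x i)) =
      (\<Sum>i\<in>{i \<in> {1..n}. i \<notin> e}. g i) / N\<^sup>2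
      + (\<Sum>t\<in>{t \<in> T. fst t \<notin> e \<and> snd t \<notin> e}. h t) / N\<^sup>2
      - 2 / (real p * N) * (\<Sum>t\<in>{t \<in> T. fst t \<in> e \<and> snd t \<notin> e}. h t)" if "e \<in> E" for e
  proof -
    have e: "e \<subseteq> {1..n}" "card e = p" and fe: "finite e"
      using that finite_subset[of e "{1..n}"] by (auto simp: E_def)
    have cardN: "real (card ({1..n} - e)) = N"
      using e fe n by (simp add: card_Diff_subset N_def of_nat_diff)
    have set1: "{(i, j). (i, j) \<in> ordered_pairs n \<and> i \<in> {1..n} - e \<and> j \<in> {1..n} - e}
        = {t \<in> T. fst t \<notin> e \<and> snd t \<notin> e}"
      by (auto simp: T_def ordered_pairs_def)
    have set2: "{t \<in> T. fst t \<in> e \<and> snd t \<notin> e} = e \<times> ({1..n} - e)"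
      using e by (auto simp: T_def ordered_pairs_def)
    have norm: "(L2_norm (proj_est L \<phi> ({1..n} - e) x))\<^sup>2 =
       ((\<Sum>i\<in>{i \<in> {1..n}. i \<notin> e}. g i) + (\<Sum>t\<in>{t \<in> T. fst t \<notin> e \<and> snd t \<notin> e}. h t)) / N\<^sup>2"
      unfolding L2_norm_proj_est[OF L Diff_subset] set1 cardN g_def h_def
      by (simp add: set_diff_eq)
    have "(\<Sum>i\<in>e. proj_est L \<phi> ({1..n} - e) x (x i)) =
        (\<Sum>i\<in>e. \<Sum>j\<in>{1..n} - e. h (i, j)) / N"
      unfolding proj_est_def cardN h_def
      by (simp add: sum_divide_distrib sum_distrib_right sum_distrib_left mult_ac)
         (subst (2) sum.swap, rule refl)
    also have "(\<Sum>i\<in>e. \<Sum>j\<in>{1..n} - e. h (i, j)) = (\<Sum>t\<in>{t \<in> T. fst t \<in> e \<and> snd t \<notin> e}. h t)"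
      unfolding set2 using fe by (simp add: sum.cartesian_product)
    finally have val: "(\<Sum>i\<in>e. proj_est L \<phi> ({1..n} - e) x (x i)) =
        (\<Sum>t\<in>{t \<in> T. fst t \<in> e \<and> snd t \<notin> e}. h t) / N" .
    have "1 / real p * (\<Sum>i\<in>e. contrast (proj_est L \<phi> ({1..n} - e) x) (x i)) =
       (L2_norm (proj_est L \<phi> ({1..n} - e) x))\<^sup>2
         - 2 / real p * (\<Sum>i\<in>e. proj_est L \<phi> ({1..n} - e) x (x i))"
      unfolding contrast_def sum_subtractf using e ppos
      by (simp add: sum_distrib_left[symmetric] field_simps)
    then show ?thesis
      unfolding norm val using Npos ppos by (simp add: field_simps)
  qed
  have card1: "card {e \<in> E. i \<notin> e} = (n - 1) choose p" if "i \<in> {1..n}" for i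
  proof -
    have "{e \<in> E. i \<notin> e} = {e. e \<subseteq> {1..n} \<and> card e = p \<and> {} \<subseteq> e \<and> e \<inter> {i} = {}}"
      by (auto simp: E_def)
    then show ?thesis
      using card_subsets_containing_avoiding[of "{1..n}" "{}" "{i}" p] that by simp
  qed
  have card2: "card {e \<in> E. fst t \<notin> e \<and> snd t \<notin> e} = (n - 2) choose p" if "t \<in> T" for t
  proof -
    have "{e \<in> E. fst t \<notin> e \<and> snd t \<notin> e}
        = {e. e \<subseteq> {1..n} \<and> card e = p \<and> {} \<subseteq> e \<and> e \<inter> {fst t, snd t} = {}}"
      by (auto simp: E_def)
    moreover have "{fst t, snd t} \<subseteq> {1..n}" "card {fst t, snd t} = 2"
      using that by (auto simp: T_def ordered_pairs_def)
    ultimately show ?thesis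
      using card_subsets_containing_avoiding[of "{1..n}" "{}" "{fst t, snd t}" p] by simp
  qed
  have card3: "card {e \<in> E. fst t \<in> e \<and> snd t \<notin> e} = (n - 2) choose (p - 1)" if "t \<in> T" for t
  proof -
    have "{e \<in> E. fst t \<in> e \<and> snd t \<notin> e}
        = {e. e \<subseteq> {1..n} \<and> card e = p \<and> {fst t} \<subseteq> e \<and> e \<inter> {snd t} = {}}"
      by (auto simp: E_def)
    moreover have "fst t \<in> {1..n}" "snd t \<in> {1..n}" "fst t \<noteq> snd t"
      using that by (auto simp: T_def ordered_pairs_def)
    ultimately show ?thesis
      using card_subsets_containing_avoiding[of "{1..n}" "{fst t}" "{snd t}" p] n
      by (simp add: numeral_2_eq_2)
  qed
  have s1: "(\<Sum>e\<in>E. \<Sum>i\<in>{i \<in> {1..n}. i \<notin> e}. g i) = real ((n - 1) choose p) * (\<Sum>i\<in>{1..n}. g i)"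
    by (rule sum_over_related) (use finE card1 in auto)
  have s2: "(\<Sum>e\<in>E. \<Sum>t\<in>{t \<in> T. fst t \<notin> e \<and> snd t \<notin> e}. h t) = real ((n - 2) choose p) * (\<Sum>t\<in>T. h t)"
    by (rule sum_over_related) (use finE finT card2 in auto)
  have s3: "(\<Sum>e\<in>E. \<Sum>t\<in>{t \<in> T. fst t \<in> e \<and> snd t \<notin> e}. h t) = real ((n - 2) choose (p - 1)) * (\<Sum>t\<in>T. h t)"
    by (rule sum_over_related) (use finE finT card3 in auto)
  let ?G = "\<Sum>i\<in>{1..n}. g i" and ?H = "\<Sum>t\<in>T. h t" and ?C = "real (n choose p)"
  have G: "diag_mean L \<phi> n x = ?G / real n"
    by (simp add: diag_mean_def g_def)
  have H: "offdiag_mean L \<phi> n x = ?H / (real n * (real n - 1))"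
    by (simp add: offdiag_mean_def h_def T_def)
  have "lpo_risk L \<phi> n p x = 1 / ?C * (\<Sum>e\<in>E. (\<Sum>i\<in>{i \<in> {1..n}. i \<notin> e}. g i) / N\<^sup>2
      + (\<Sum>t\<in>{t \<in> T. fst t \<notin> e \<and> snd t \<notin> e}. h t) / N\<^sup>2
      - 2 / (real p * N) * (\<Sum>t\<in>{t \<in> T. fst t \<in> e \<and> snd t \<notin> e}. h t))"
    unfolding lpo_risk_def E_def[symmetric] using per_e by simp
  also have "\<dots> = 1 / ?C * (real ((n - 1) choose p) * ?G / N\<^sup>2 + real ((n - 2) choose p) * ?H / N\<^sup>2
      - 2 / (real p * N) * (real ((n - 2) choose (p - 1)) * ?H))"
    unfolding sum.distrib sum_subtractf sum_divide_distrib[symmetric] sum_distrib_left[symmetric] s1 s2 s3 ..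
  also have "\<dots> = real ((n - 1) choose p) / ?C * ?G / N\<^sup>2 + real ((n - 2) choose p) / ?C * ?H / N\<^sup>2
      - 2 / (real p * N) * (real ((n - 2) choose (p - 1)) / ?C * ?H)"
    by (simp add: right_diff_distrib distrib_left)
  also have "\<dots> = N / real n * ?G / N\<^sup>2 + N * (N - 1) / (real n * (real n - 1)) * ?H / N\<^sup>2
      - 2 / (real p * N) * (real p * N / (real n * (real n - 1)) * ?H)"
    using binomial_ratios[OF n(2,3)] by (simp add: N_def)
  also have "\<dots> = 1 / N * (?G / real n - ?H / (real n * (real n - 1))) - ?H / (real n * (real n - 1))"
  proof -
    define P where "P = ?H / (real n * (real n - 1))"
    have a: "N * (N - 1) / (real n * (real n - 1)) * ?H / N\<^sup>2 = (N - 1) / N * P"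
      using Npos unfolding P_def by (simp add: power2_eq_square)
    have b: "2 / (real p * N) * (real p * N / (real n * (real n - 1)) * ?H) = 2 * P"
      using Npos ppos unfolding P_def by simp
    have c: "N / real n * ?G / N\<^sup>2 = 1 / N * (?G / real n)"
      using Npos by (simp add: power2_eq_square)
    show ?thesis unfolding a b c P_def[symmetric] using Npos by (simp add: field_simps)
  qed
  finally show ?thesis unfolding G H Npos' .
qed

lemma est_loss_closed_form:
  assumes L: "finite L" "orthonormal_family L \<phi>" and s: "L2_unit s" and n: "2 \<le> n"
  shows "est_loss X s L \<phi> n w =
           (diag_mean L \<phi> n (\<lambda>i. X i w) + (real n - 1) * offdiag_mean L \<phi> n (\<lambda>i. X i w)) / real n
           - 2 / real n * (\<Sum>i\<in>{1..n}. \<Sum>l\<in>L. L2_inner s (\<phi> l) * \<phi> l (X i w))"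
proof -
  define c where "c l = 1 / real n * (\<Sum>i\<in>{1..n}. \<phi> l (X i w))" for l
  have u: "proj_est L \<phi> {1..n} (\<lambda>i. X i w) = (\<lambda>t. \<Sum>l\<in>L. c l * \<phi> l t)"
    by (simp add: proj_est_def c_def)
  have set: "{(i, j). (i, j) \<in> ordered_pairs n \<and> i \<in> {1..n} \<and> j \<in> {1..n}} = ordered_pairs n"
    by (auto simp: ordered_pairs_def)
  have norm: "(L2_norm (proj_est L \<phi> {1..n} (\<lambda>i. X i w)))\<^sup>2 =
      (diag_mean L \<phi> n (\<lambda>i. X i w) + (real n - 1) * offdiag_mean L \<phi> n (\<lambda>i. X i w)) / real n"
    unfolding L2_norm_proj_est[OF L order.refl] set diag_mean_def offdiag_mean_def
    using n by (simp add: field_simps power2_eq_square)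
  have int: "integrable unit_lebesgue (\<lambda>t. s t * \<phi> l t)" if "l \<in> L" for l
    using L(2) that s by (intro L2_unit_mult_integrable) (auto simp: orthonormal_family_def)
  have "(LINT t|unit_lebesgue. s t * (\<Sum>l\<in>L. c l * \<phi> l t))
      = (LINT t|unit_lebesgue. (\<Sum>l\<in>L. c l * (s t * \<phi> l t)))"
    by (intro Bochner_Integration.integral_cong refl) (simp add: sum_distrib_left mult_ac)
  also have "\<dots> = (\<Sum>l\<in>L. c l * L2_inner s (\<phi> l))"
    using int unfolding L2_inner_def by (subst Bochner_Integration.integral_sum) auto
  also have "\<dots> = 1 / real n * (\<Sum>i\<in>{1..n}. \<Sum>l\<in>L. L2_inner s (\<phi> l) * \<phi> l (X i w))"
    unfolding c_def by (subst sum.swap) (simp add: sum_distrib_left sum_divide_distrib mult_ac)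
  finally show ?thesis
    unfolding est_loss_def Let_def norm unfolding u by simp
qed

section \<open>Independent observations with a common density\<close>

context prob_space
begin

lemma sq_integrable_const: "sq_integrable M (\<lambda>_. c)"
  by (simp add: sq_integrable_def)

lemma sq_integrable_imp_integrable: "sq_integrable M Y \<Longrightarrow> integrable M Y"
  unfolding sq_integrable_def by (auto intro: square_integrable_imp_integrable)

lemma has_var_imp_sq_integrable:
  assumes "has_var M Y"
  shows "sq_integrable M Y"
proof -
  let ?m = "LINT v|M. Y v"
  have m: "Y \<in> borel_measurable M"
    using assms by (auto simp: has_var_def)
  then have "sq_integrable M (\<lambda>w. Y w - ?m)"
    using assms by (auto simp: has_var_def sq_integrable_def)
  from sq_integrable_add[OF this sq_integrable_const[of ?m]] show ?thesis
    by simp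
qed

end

locale iid_sample = prob_space \<Omega> for \<Omega> :: "'a measure" +
  fixes X :: "nat \<Rightarrow> 'a \<Rightarrow> real" and s :: "real \<Rightarrow> real"
  assumes density_nonneg: "x \<in> {0..1} \<Longrightarrow> 0 \<le> s x"
    and X_distributed: "1 \<le> i \<Longrightarrow> distributed \<Omega> unit_lebesgue (X i) (\<lambda>x. ennreal (s x))"
    and X_indep: "indep_vars (\<lambda>_. unit_lebesgue) X {1..}"
begin

lemma X_measurable [measurable]: "1 \<le> i \<Longrightarrow> X i \<in> measurable \<Omega> unit_lebesgue"
  using X_distributed by (auto simp: distributed_def)

lemma coordinate_measurable:
  fixes f :: "real \<Rightarrow> real" and j :: nat
  assumes "f \<in> borel_measurable unit_lebesgue" "j \<in> J"
  shows "(\<lambda>y. f (y j)) \<in> borel_measurable (PiM J (\<lambda>_. unit_lebesgue))"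
  by (rule measurable_compose[OF _ assms(1)]) (rule measurable_component_singleton[OF assms(2)])

lemma density_nonneg_space: "x \<in> space unit_lebesgue \<Longrightarrow> 0 \<le> s x"
  using density_nonneg by (simp add: unit_lebesgue_def space_restrict_space)

lemma expectation_density:
  fixes f :: "real \<Rightarrow> real"
  assumes "f \<in> borel_measurable unit_lebesgue" "1 \<le> i"
  shows "(LINT x|unit_lebesgue. s x * f x) = expectation (\<lambda>w. f (X i w))"
  using assms X_distributed density_nonneg_space by (intro distributed_integral) auto

lemma expectation_identical:
  fixes f :: "real \<Rightarrow> real"
  assumes "f \<in> borel_measurable unit_lebesgue" "1 \<le> i"
  shows "expectation (\<lambda>w. f (X i w)) = expectation (\<lambda>w. f (X 1 w))"
  using expectation_density[of f i] expectation_density[of f 1] assms by simp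

lemma sq_integrable_identical:
  assumes "f \<in> borel_measurable unit_lebesgue" "1 \<le> i" "sq_integrable \<Omega> (\<lambda>w. f (X 1 w))"
  shows "sq_integrable \<Omega> (\<lambda>w. f (X i w))"
proof -
  have m: "(\<lambda>x. (f x)\<^sup>2) \<in> borel_measurable unit_lebesgue"
    using assms(1) by measurable
  have "integrable unit_lebesgue (\<lambda>x. s x * (f x)\<^sup>2)"
    using distributed_integrable[OF X_distributed[of 1] m density_nonneg_space] assms(3)
    by (simp add: sq_integrable_def)
  then have "integrable \<Omega> (\<lambda>w. (f (X i w))\<^sup>2)"
    using distributed_integrable[OF X_distributed[OF assms(2)] m density_nonneg_space] by simp
  then show ?thesis
    using assms(1,2) by (simp add: sq_integrable_def)
qed

text \<open>One observation against an arbitrary function of finitely many others. The second factor is given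
  as a function on the product space because the kernels below depend on up to three
  observations, some of which may coincide.\<close>

lemma expectation_mult_indep:
  fixes f :: "real \<Rightarrow> real" and F :: "(nat \<Rightarrow> real) \<Rightarrow> real"
  assumes i: "1 \<le> i" "i \<notin> J" "J \<subseteq> {1..}"
    and f: "f \<in> borel_measurable unit_lebesgue" "integrable \<Omega> (\<lambda>w. f (X i w))"
    and F: "F \<in> borel_measurable (PiM J (\<lambda>_. unit_lebesgue))"
      "integrable \<Omega> (\<lambda>w. F (\<lambda>j\<in>J. X j w))"
  shows "expectation (\<lambda>w. f (X i w) * F (\<lambda>j\<in>J. X j w)) =
           expectation (\<lambda>w. f (X i w)) * expectation (\<lambda>w. F (\<lambda>j\<in>J. X j w))"
proof -
  have "indep_var (PiM {i} (\<lambda>_. unit_lebesgue)) (\<lambda>w. \<lambda>j\<in>{i}. X j w)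
          (PiM J (\<lambda>_. unit_lebesgue)) (\<lambda>w. \<lambda>j\<in>J. X j w)"
    using i by (intro indep_var_restrict[OF X_indep]) auto
  from indep_var_compose[OF this, of "\<lambda>y. f (y i)" borel F borel]
  have "indep_var borel ((\<lambda>y. f (y i)) \<circ> (\<lambda>w. \<lambda>j\<in>{i}. X j w)) borel (F \<circ> (\<lambda>w. \<lambda>j\<in>J. X j w))"
    using f F by measurable
  then have "indep_var borel (\<lambda>w. f (X i w)) borel (\<lambda>w. F (\<lambda>j\<in>J. X j w))"
    by (simp add: comp_def)
  then show ?thesis
    using f(2) F(2) by (intro indep_var_lebesgue_integral)
qed

end

section \<open>Hoeffding decomposition of the Gram kernel\<close>

text \<open>Square integrability of the squared length of the vector of coordinates is a fourth moment
  condition on each coordinate; it makes products of any two centred coordinates square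
  integrable, hence all variances and covariances below finite.\<close>

locale projection_moments = iid_sample \<Omega> X s
  for \<Omega> :: "'a measure" and X :: "nat \<Rightarrow> 'a \<Rightarrow> real" and s :: "real \<Rightarrow> real" +
  fixes L :: "'l set" and \<phi> :: "'l \<Rightarrow> real \<Rightarrow> real"
  assumes finite_L: "finite L"
    and basis_measurable: "l \<in> L \<Longrightarrow> \<phi> l \<in> borel_measurable unit_lebesgue"
    and fourth_moment: "sq_integrable \<Omega> (sq_sum X L \<phi> 1)"
begin

definition mean_coef :: "'l \<Rightarrow> real" where
  "mean_coef l = expectation (\<lambda>w. \<phi> l (X 1 w))"

definition mean_norm2 :: real where
  "mean_norm2 = (\<Sum>l\<in>L. (mean_coef l)\<^sup>2)"

definition dev :: "'l \<Rightarrow> real \<Rightarrow> real" where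
  "dev l x = \<phi> l x - mean_coef l"

definition diag_dev :: "real \<Rightarrow> real" where
  "diag_dev x = (\<Sum>l\<in>L. (\<phi> l x)\<^sup>2) - expectation (sq_sum X L \<phi> 1)"

text \<open>The first order projection of the Gram kernel: the conditional expectation of
  \<open>\<Sum>l\<in>L. \<phi> l x * \<phi> l (X j)\<close> at fixed \<open>x\<close>, minus its mean.\<close>

definition lin :: "real \<Rightarrow> real" where
  "lin x = (\<Sum>l\<in>L. mean_coef l * dev l x)"

text \<open>The completely degenerate part of the Gram kernel: its expectation in either argument vanishes
  when the other one is held fixed.\<close>

definition degen :: "real \<Rightarrow> real \<Rightarrow> real" where
  "degen x y = (\<Sum>l\<in>L. dev l x * dev l y)"

lemma dev_measurable [measurable]: "l \<in> L \<Longrightarrow> dev l \<in> borel_measurable unit_lebesgue"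
  unfolding dev_def[abs_def] using basis_measurable by measurable

lemma diag_dev_measurable [measurable]: "diag_dev \<in> borel_measurable unit_lebesgue"
  unfolding diag_dev_def[abs_def] using basis_measurable by measurable

lemma lin_measurable [measurable]: "lin \<in> borel_measurable unit_lebesgue"
  unfolding lin_def[abs_def] by measurable

lemma degen_measurable [measurable]:
  assumes "f \<in> measurable N unit_lebesgue" "g \<in> measurable N unit_lebesgue"
  shows "(\<lambda>y. degen (f y) (g y)) \<in> borel_measurable N"
proof -
  have "(\<lambda>y. dev l (f y)) \<in> borel_measurable N" "(\<lambda>y. dev l (g y)) \<in> borel_measurable N" if "l \<in> L" for l
    using assms dev_measurable[OF that] by (auto intro: measurable_compose)
  then show ?thesis
    unfolding degen_def by (intro borel_measurable_sum borel_measurable_times) auto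
qed

lemma degen_commute: "degen x y = degen y x"
  by (simp add: degen_def mult.commute)

lemma hoeffding_decomposition:
  "(\<Sum>l\<in>L. \<phi> l x * \<phi> l y) = mean_norm2 + lin x + lin y + degen x y"
  unfolding mean_norm2_def lin_def degen_def dev_def sum.distrib[symmetric]
  by (intro sum.cong refl) (simp add: power2_eq_square algebra_simps)

lemma sq_integrable_basis_square:
  assumes "l \<in> L"
  shows "sq_integrable \<Omega> (\<lambda>w. (\<phi> l (X 1 w))\<^sup>2)"
proof (rule sq_integrable_dominated[OF fourth_moment])
  show "(\<lambda>w. (\<phi> l (X 1 w))\<^sup>2) \<in> borel_measurable \<Omega>"
    using basis_measurable[OF assms] X_measurable[of 1] by measurable
  show "\<bar>(\<phi> l (X 1 w))\<^sup>2\<bar> \<le> \<bar>sq_sum X L \<phi> 1 w\<bar>" for w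
  proof -
    have "(\<phi> l (X 1 w))\<^sup>2 \<le> sq_sum X L \<phi> 1 w"
      unfolding sq_sum_def using finite_L assms by (intro member_le_sum) auto
    then show ?thesis by simp
  qed
qed

lemma sq_integrable_basis:
  assumes "l \<in> L" shows "sq_integrable \<Omega> (\<lambda>w. \<phi> l (X 1 w))"
  using sq_integrable_imp_integrable[OF sq_integrable_basis_square[OF assms]]
    basis_measurable[OF assms] X_measurable[of 1]
  by (auto simp: sq_integrable_def)

lemma sq_integrable_dev_square:
  assumes "l \<in> L" "1 \<le> i"
  shows "sq_integrable \<Omega> (\<lambda>w. (dev l (X i w))\<^sup>2)"
proof (rule sq_integrable_identical[where f = "\<lambda>x. (dev l x)\<^sup>2"])
  have "sq_integrable \<Omega> (\<lambda>w. (\<phi> l (X 1 w))\<^sup>2 - 2 * mean_coef l * \<phi> l (X 1 w) + (mean_coef l)\<^sup>2)"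
    using assms(1) by (intro sq_integrable_add sq_integrable_diff sq_integrable_cmult sq_integrable_const
        sq_integrable_basis sq_integrable_basis_square)
  then show "sq_integrable \<Omega> (\<lambda>w. (dev l (X 1 w))\<^sup>2)"
    by (simp add: dev_def power2_diff algebra_simps)
qed (use assms in measurable)

lemma sq_integrable_dev:
  assumes "l \<in> L" "1 \<le> i"
  shows "sq_integrable \<Omega> (\<lambda>w. dev l (X i w))"
  using sq_integrable_imp_integrable[OF sq_integrable_dev_square[OF assms]] assms
  by (auto simp: sq_integrable_def)

lemma sq_integrable_dev_mult_dev:
  assumes "l \<in> L" "k \<in> L" "1 \<le> i" "1 \<le> j"
  shows "sq_integrable \<Omega> (\<lambda>w. dev l (X i w) * dev k (X j w))"
  using assms sq_integrable_dev_square
  by (intro sq_integrable_mult_of_squares) auto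

lemma sq_integrable_lin: "1 \<le> i \<Longrightarrow> sq_integrable \<Omega> (\<lambda>w. lin (X i w))"
  unfolding lin_def by (intro sq_integrable_sum sq_integrable_cmult sq_integrable_dev)

lemma sq_integrable_degen:
  "1 \<le> i \<Longrightarrow> 1 \<le> j \<Longrightarrow> sq_integrable \<Omega> (\<lambda>w. degen (X i w) (X j w))"
  unfolding degen_def by (intro sq_integrable_sum sq_integrable_dev_mult_dev)

lemma sq_integrable_diag_dev:
  assumes "1 \<le> i"
  shows "sq_integrable \<Omega> (\<lambda>w. diag_dev (X i w))"
proof (rule sq_integrable_identical[OF _ assms])
  show "sq_integrable \<Omega> (\<lambda>w. diag_dev (X 1 w))"
    using sq_integrable_diff[OF fourth_moment sq_integrable_const]
    by (simp add: diag_dev_def sq_sum_def)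
qed measurable

lemma expectation_dev: "l \<in> L \<Longrightarrow> 1 \<le> i \<Longrightarrow> expectation (\<lambda>w. dev l (X i w)) = 0"
  using sq_integrable_imp_integrable[OF sq_integrable_basis[of l]]
  by (simp add: expectation_identical[of "dev l" i])
     (simp add: dev_def mean_coef_def prob_space)

lemma expectation_lin: "1 \<le> i \<Longrightarrow> expectation (\<lambda>w. lin (X i w)) = 0"
  unfolding lin_def using expectation_dev sq_integrable_imp_integrable[OF sq_integrable_dev]
  by (subst Bochner_Integration.integral_sum) auto

lemma expectation_diag_dev: "1 \<le> i \<Longrightarrow> expectation (\<lambda>w. diag_dev (X i w)) = 0"
  using sq_integrable_imp_integrable[OF fourth_moment]
  by (simp add: expectation_identical[of diag_dev i])
     (simp add: diag_dev_def sq_sum_def[abs_def] prob_space)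

text \<open>The observation \<open>X i\<close> occurs only in the centred factors \<open>dev l (X i)\<close>, which are independent of
  everything else. The factor \<open>F\<close> may involve \<open>X j\<close>, which is what the two corollaries below
  need.\<close>

lemma degen_orthogonal:
  assumes "1 \<le> i" "i \<notin> J" "J \<subseteq> {1..}" "j \<in> J"
    and F: "F \<in> borel_measurable (PiM J (\<lambda>_. unit_lebesgue))"
      "sq_integrable \<Omega> (\<lambda>w. F (\<lambda>j\<in>J. X j w))"
  shows "expectation (\<lambda>w. degen (X i w) (X j w) * F (\<lambda>j\<in>J. X j w)) = 0"
proof -
  have j: "1 \<le> j" using assms(3,4) by auto
  let ?Y = "\<lambda>w. F (\<lambda>j\<in>J. X j w)"
  have "expectation (\<lambda>w. degen (X i w) (X j w) * ?Y w)
      = expectation (\<lambda>w. \<Sum>l\<in>L. dev l (X i w) * dev l (X j w) * ?Y w)"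
    by (simp add: degen_def sum_distrib_right)
  also have "\<dots> = (\<Sum>l\<in>L. expectation (\<lambda>w. dev l (X i w) * dev l (X j w) * ?Y w))"
    using assms(1) j F(2) by (intro Bochner_Integration.integral_sum)
      (auto intro!: sq_integrable_mult sq_integrable_dev_mult_dev)
  also have "\<dots> = 0"
  proof (rule sum.neutral, rule ballI)
    fix l assume l: "l \<in> L"
    let ?F = "\<lambda>y. dev l (y j) * F y"
    have "?F \<in> borel_measurable (PiM J (\<lambda>_. unit_lebesgue))"
      using F(1) coordinate_measurable[OF dev_measurable[OF l] assms(4)]
      by (rule borel_measurable_times[rotated])
    moreover have "integrable \<Omega> (\<lambda>w. ?F (\<lambda>j\<in>J. X j w))"
      using sq_integrable_mult[OF sq_integrable_dev[OF l j] F(2)] assms(4) by simp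
    ultimately have "expectation (\<lambda>w. dev l (X i w) * ?F (\<lambda>j\<in>J. X j w)) = 0"
      using assms(1-3) l expectation_dev[OF l assms(1)]
        sq_integrable_imp_integrable[OF sq_integrable_dev[OF l assms(1)]]
      by (subst expectation_mult_indep[where f = "dev l" and F = ?F]) auto
    then show "expectation (\<lambda>w. dev l (X i w) * dev l (X j w) * ?Y w) = 0"
      using assms(4) by (simp add: mult.assoc)
  qed
  finally show ?thesis .
qed

text \<open>One of the two indices \<open>i\<close>, \<open>j\<close> differs from \<open>k\<close>, and that observation is free.\<close>

lemma degen_orthogonal_to_single:
  assumes "1 \<le> i" "1 \<le> j" "i \<noteq> j" "1 \<le> k"
    and f: "f \<in> borel_measurable unit_lebesgue" "sq_integrable \<Omega> (\<lambda>w. f (X k w))"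
  shows "expectation (\<lambda>w. degen (X i w) (X j w) * f (X k w)) = 0"
proof -
  have *: "expectation (\<lambda>w. degen (X i w) (X j w) * f (X k w)) = 0"
    if "1 \<le> i" "1 \<le> j" "i \<noteq> j" "i \<noteq> k" for i j
  proof -
    have "(\<lambda>y. f (y k)) \<in> borel_measurable (PiM {j, k} (\<lambda>_. unit_lebesgue))"
      using f(1) by (intro coordinate_measurable) auto
    then show ?thesis
      using degen_orthogonal[of i "{j, k}" j "\<lambda>y. f (y k)"] that assms(4) f(2) by simp
  qed
  show ?thesis
  proof (cases "i = k")
    case True
    then show ?thesis using *[of j i] assms by (simp add: degen_commute)
  qed (use * assms in simp)
qed

text \<open>Since the index pairs differ, one of \<open>i\<close>, \<open>j\<close> lies outside \<open>{k, r}\<close>.\<close>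

lemma degen_orthogonal_to_degen:
  assumes "1 \<le> i" "1 \<le> j" "i \<noteq> j" "1 \<le> k" "1 \<le> r" "{i, j} \<noteq> {k, r}" "k \<noteq> r"
  shows "expectation (\<lambda>w. degen (X i w) (X j w) * degen (X k w) (X r w)) = 0"
proof -
  have *: "expectation (\<lambda>w. degen (X i w) (X j w) * degen (X k w) (X r w)) = 0"
    if "1 \<le> i" "1 \<le> j" "i \<noteq> j" "i \<noteq> k" "i \<noteq> r" for i j
  proof -
    have "(\<lambda>y. degen (y k) (y r)) \<in> borel_measurable (PiM {j, k, r} (\<lambda>_. unit_lebesgue))"
      by (intro degen_measurable measurable_component_singleton) auto
    then show ?thesis
      using degen_orthogonal[of i "{j, k, r}" j "\<lambda>y. degen (y k) (y r)"]
        sq_integrable_degen[of k r] that assms(4,5) by simp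
  qed
  show ?thesis
  proof (cases "i = k \<or> i = r")
    case True
    then show ?thesis using *[of j i] assms by (auto simp: degen_commute)
  qed (use * assms in simp)
qed

lemma centred_single_orthogonal:
  fixes f g :: "real \<Rightarrow> real"
  assumes "1 \<le> i" "1 \<le> j" "i \<noteq> j"
    and f: "f \<in> borel_measurable unit_lebesgue" "integrable \<Omega> (\<lambda>w. f (X i w))"
    and g: "g \<in> borel_measurable unit_lebesgue" "integrable \<Omega> (\<lambda>w. g (X j w))"
    and zero: "expectation (\<lambda>w. g (X j w)) = 0"
  shows "expectation (\<lambda>w. f (X i w) * g (X j w)) = 0"
proof -
  have "(\<lambda>y. g (y j)) \<in> borel_measurable (PiM {j} (\<lambda>_. unit_lebesgue))"
    using g(1) by (intro coordinate_measurable) auto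
  then show ?thesis
    using expectation_mult_indep[of i "{j}" f "\<lambda>y. g (y j)"] assms by simp
qed

text \<open>The squared Hilbert-Schmidt norm of the covariance matrix of the coordinates, which is the second
  moment of the degenerate kernel at two distinct observations.\<close>

definition degen_norm2 :: real where
  "degen_norm2 = (\<Sum>l\<in>L. \<Sum>k\<in>L. (expectation (\<lambda>w. dev l (X 1 w) * dev k (X 1 w)))\<^sup>2)"

lemma expectation_degen_square:
  assumes "1 \<le> i" "1 \<le> j" "i \<noteq> j"
  shows "expectation (\<lambda>w. degen (X i w) (X j w) * degen (X i w) (X j w)) = degen_norm2"
proof -
  have "expectation (\<lambda>w. (dev l (X i w) * dev l (X j w)) * (dev k (X i w) * dev k (X j w)))
      = (expectation (\<lambda>w. dev l (X 1 w) * dev k (X 1 w)))\<^sup>2" if lk: "l \<in> L" "k \<in> L" for l k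
  proof -
    let ?f = "\<lambda>x. dev l x * dev k x"
    have f: "?f \<in> borel_measurable unit_lebesgue" using lk by measurable
    have F: "(\<lambda>y. ?f (y j)) \<in> borel_measurable (PiM {j} (\<lambda>_. unit_lebesgue))"
      using f by (intro coordinate_measurable) auto
    have "expectation (\<lambda>w. ?f (X i w) * ?f (X j w))
        = expectation (\<lambda>w. ?f (X i w)) * expectation (\<lambda>w. ?f (X j w))"
      using expectation_mult_indep[of i "{j}" ?f "\<lambda>y. ?f (y j)"] assms f F
        sq_integrable_imp_integrable[OF sq_integrable_dev_mult_dev[OF lk]] by simp
    also have "\<dots> = (expectation (\<lambda>w. ?f (X 1 w)))\<^sup>2"
      using expectation_identical[OF f assms(1)] expectation_identical[OF f assms(2)]
      by (simp add: power2_eq_square)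
    finally show ?thesis by (simp add: mult_ac)
  qed
  then show ?thesis
    unfolding degen_def degen_norm2_def using assms
    by (subst integral_sum_mult_sum) (auto intro!: sq_integrable_dev_mult_dev sum.cong)
qed

lemma expectation_sum_singles_square:
  assumes f: "f \<in> borel_measurable unit_lebesgue" "sq_integrable \<Omega> (\<lambda>w. f (X 1 w))"
    and zero: "expectation (\<lambda>w. f (X 1 w)) = 0"
  shows "expectation (\<lambda>w. (\<Sum>i\<in>{1..n}. f (X i w))\<^sup>2) = real n * expectation (\<lambda>w. (f (X 1 w))\<^sup>2)"
proof -
  have sq: "sq_integrable \<Omega> (\<lambda>w. f (X i w))" if "1 \<le> i" for i
    using sq_integrable_identical[OF f(1) that f(2)] .
  have "expectation (\<lambda>w. f (X i w) * f (X j w)) = (if j = i then expectation (\<lambda>w. (f (X 1 w))\<^sup>2) else 0)"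
    if "1 \<le> i" "1 \<le> j" for i j
  proof (cases "i = j")
    case True
    then show ?thesis
      using expectation_identical[of "\<lambda>x. (f x)\<^sup>2" i] f(1) that by (simp add: power2_eq_square)
  next
    case False
    then show ?thesis
      using centred_single_orthogonal[OF that False f(1) _ f(1)] sq that zero
        expectation_identical[OF f(1) that(2)] by (simp add: sq_integrable_imp_integrable)
  qed
  then have "(\<Sum>i\<in>{1..n}. \<Sum>j\<in>{1..n}. expectation (\<lambda>w. f (X i w) * f (X j w)))
      = (\<Sum>i\<in>{1..n}. \<Sum>j\<in>{1..n}. if j = i then expectation (\<lambda>w. (f (X 1 w))\<^sup>2) else 0)"
    by (intro sum.cong refl) auto
  then show ?thesis
    unfolding power2_eq_square using sq by (subst integral_sum_mult_sum) (auto simp: power2_eq_square)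
qed

text \<open>Each ordered pair correlates with itself and with its transpose, whence the factor 2.\<close>

lemma expectation_sum_degen_square:
  assumes n: "1 \<le> n"
  shows "expectation (\<lambda>w. (\<Sum>t\<in>ordered_pairs n. degen (X (fst t) w) (X (snd t) w))\<^sup>2)
     = 2 * (real n * (real n - 1)) * degen_norm2"
proof -
  let ?Z = "\<lambda>t w. degen (X (fst t) w) (X (snd t) w)"
  let ?T = "ordered_pairs n"
  have row: "(\<Sum>u\<in>?T. expectation (\<lambda>w. ?Z t w * ?Z u w)) = 2 * degen_norm2" if t: "t \<in> ?T" for t
  proof -
    obtain i j where ij: "t = (i, j)" "1 \<le> i" "1 \<le> j" "i \<noteq> j" "(j, i) \<in> ?T"
      using t by (auto simp: ordered_pairs_def)
    have "(\<Sum>u\<in>?T. expectation (\<lambda>w. ?Z t w * ?Z u w))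
        = (\<Sum>u\<in>{(i, j), (j, i)}. expectation (\<lambda>w. ?Z t w * ?Z u w))"
    proof (rule sum.mono_neutral_right)
      show "\<forall>u\<in>?T - {(i, j), (j, i)}. expectation (\<lambda>w. ?Z t w * ?Z u w) = 0"
      proof
        fix u assume u: "u \<in> ?T - {(i, j), (j, i)}"
        then have "{i, j} \<noteq> {fst u, snd u}"
          by (cases u) (auto simp: doubleton_eq_iff)
        then show "expectation (\<lambda>w. ?Z t w * ?Z u w) = 0"
          using u ij degen_orthogonal_to_degen[of i j "fst u" "snd u"]
          by (auto simp: ordered_pairs_def)
      qed
    qed (use t ij in auto)
    also have "\<dots> = 2 * degen_norm2"
      using ij expectation_degen_square[of i j] by (simp add: degen_commute[of "X j _" "X i _"])
    finally show ?thesis .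
  qed
  have "expectation (\<lambda>w. (\<Sum>t\<in>?T. ?Z t w)\<^sup>2) = (\<Sum>t\<in>?T. \<Sum>u\<in>?T. expectation (\<lambda>w. ?Z t w * ?Z u w))"
    unfolding power2_eq_square
    by (rule integral_sum_mult_sum) (auto intro!: sq_integrable_degen simp: ordered_pairs_def)
  also have "\<dots> = real (card ?T) * (2 * degen_norm2)"
    using row by simp
  finally show ?thesis
    using card_ordered_pairs[OF n] by simp
qed

section \<open>Bias and variance of the risk estimator\<close>

text \<open>The trace of the covariance matrix of the coordinates.\<close>

definition excess :: real where
  "excess = expectation (sq_sum X L \<phi> 1) - mean_norm2"

text \<open>The single-observation part of \<open>diag_mean - offdiag_mean\<close>, the factor of \<open>t = 1 / (n - p)\<close> in
  the risk estimator.\<close>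

definition slope :: "real \<Rightarrow> real" where
  "slope x = diag_dev x - 2 * lin x"

text \<open>The first order Hoeffding projection of the risk estimator is the average of
  \<open>risk_lin t (X i)\<close> with \<open>t = 1 / (n - p)\<close>.\<close>

definition risk_lin :: "real \<Rightarrow> real \<Rightarrow> real" where
  "risk_lin t x = t * slope x - 2 * lin x"

definition degen_mean :: "nat \<Rightarrow> 'a \<Rightarrow> real" where
  "degen_mean n w = (\<Sum>t\<in>ordered_pairs n. degen (X (fst t) w) (X (snd t) w)) / (real n * (real n - 1))"

lemma slope_measurable [measurable]: "slope \<in> borel_measurable unit_lebesgue"
  unfolding slope_def[abs_def] by measurable

lemma risk_lin_measurable [measurable]: "risk_lin t \<in> borel_measurable unit_lebesgue"
  unfolding risk_lin_def[abs_def] by measurable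

lemma sq_integrable_slope: "1 \<le> i \<Longrightarrow> sq_integrable \<Omega> (\<lambda>w. slope (X i w))"
  unfolding slope_def
  by (intro sq_integrable_diff sq_integrable_cmult sq_integrable_lin sq_integrable_diag_dev)

lemma sq_integrable_risk_lin: "1 \<le> i \<Longrightarrow> sq_integrable \<Omega> (\<lambda>w. risk_lin t (X i w))"
  unfolding risk_lin_def
  by (intro sq_integrable_diff sq_integrable_cmult sq_integrable_slope sq_integrable_lin)

lemma expectation_slope: "1 \<le> i \<Longrightarrow> expectation (\<lambda>w. slope (X i w)) = 0"
  unfolding slope_def
  using expectation_lin expectation_diag_dev
    sq_integrable_imp_integrable[OF sq_integrable_lin] sq_integrable_imp_integrable[OF sq_integrable_diag_dev]
  by simp

lemma expectation_risk_lin: "1 \<le> i \<Longrightarrow> expectation (\<lambda>w. risk_lin t (X i w)) = 0"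
  unfolding risk_lin_def
  using expectation_lin expectation_slope
    sq_integrable_imp_integrable[OF sq_integrable_lin] sq_integrable_imp_integrable[OF sq_integrable_slope]
  by simp

lemma expectation_degen:
  assumes "1 \<le> i" "1 \<le> j" "i \<noteq> j"
  shows "expectation (\<lambda>w. degen (X i w) (X j w)) = 0"
  using degen_orthogonal_to_single[OF assms assms(1), of "\<lambda>_. 1"] sq_integrable_const by simp

lemma sq_integrable_degen_mean: "sq_integrable \<Omega> (degen_mean n)"
proof -
  have "sq_integrable \<Omega> (\<lambda>w. 1 / (real n * (real n - 1)) *
          (\<Sum>t\<in>ordered_pairs n. degen (X (fst t) w) (X (snd t) w)))"
    by (intro sq_integrable_cmult sq_integrable_sum sq_integrable_degen) (auto simp: ordered_pairs_def)
  then show ?thesis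
    by (simp add: degen_mean_def[abs_def])
qed

lemma expectation_degen_mean: "expectation (degen_mean n) = 0"
proof -
  have "expectation (\<lambda>w. \<Sum>t\<in>ordered_pairs n. degen (X (fst t) w) (X (snd t) w))
      = (\<Sum>t\<in>ordered_pairs n. expectation (\<lambda>w. degen (X (fst t) w) (X (snd t) w)))"
    by (rule Bochner_Integration.integral_sum)
       (auto simp: ordered_pairs_def intro!: sq_integrable_imp_integrable[OF sq_integrable_degen])
  also have "\<dots> = 0"
    by (intro sum.neutral) (auto simp: ordered_pairs_def expectation_degen)
  finally show ?thesis
    by (simp add: degen_mean_def[abs_def])
qed

lemma expectation_sum_of_centred:
  assumes "\<And>i. 1 \<le> i \<Longrightarrow> integrable \<Omega> (\<lambda>w. f (X i w))" "\<And>i. 1 \<le> i \<Longrightarrow> expectation (\<lambda>w. f (X i w)) = 0"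
  shows "integrable \<Omega> (\<lambda>w. \<Sum>i\<in>{1..n}. f (X i w))"
    and "expectation (\<lambda>w. \<Sum>i\<in>{1..n}. (f (X i w) :: real)) = 0"
proof -
  show "integrable \<Omega> (\<lambda>w. \<Sum>i\<in>{1..n}. f (X i w))"
    using assms(1) by (intro Bochner_Integration.integrable_sum) auto
  show "expectation (\<lambda>w. \<Sum>i\<in>{1..n}. f (X i w)) = 0"
    using assms by (subst Bochner_Integration.integral_sum) auto
qed

lemma diag_mean_decomposition:
  assumes "1 \<le> n"
  shows "diag_mean L \<phi> n (\<lambda>i. X i w) =
           mean_norm2 + excess + (\<Sum>i\<in>{1..n}. diag_dev (X i w)) / real n"
  using assms unfolding diag_mean_def diag_dev_def excess_def
  by (simp add: sum_subtractf diff_divide_distrib)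

text \<open>Each observation is a member of \<open>2 * (n - 1)\<close> ordered pairs, so the linear part has the weight
  \<open>2 / n\<close>.\<close>

lemma offdiag_mean_decomposition:
  assumes "2 \<le> n"
  shows "offdiag_mean L \<phi> n (\<lambda>i. X i w) =
           mean_norm2 + 2 / real n * (\<Sum>i\<in>{1..n}. lin (X i w)) + degen_mean n w"
proof -
  let ?T = "ordered_pairs n"
  have c: "real n * (real n - 1) \<noteq> 0" using assms by auto
  have fst: "(\<Sum>t\<in>?T. lin (X (fst t) w)) = (real n - 1) * (\<Sum>i\<in>{1..n}. lin (X i w))"
  proof -
    have "(\<Sum>t\<in>?T. lin (X (fst t) w)) = (\<Sum>i\<in>{1..n}. \<Sum>j\<in>{1..n} - {i}. lin (X i w))"
      unfolding ordered_pairs_eq by (subst sum.Sigma) (auto simp: split_def)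
    then show ?thesis
      using assms by (simp add: sum_distrib_left of_nat_diff)
  qed
  have snd: "(\<Sum>t\<in>?T. lin (X (snd t) w)) = (\<Sum>t\<in>?T. lin (X (fst t) w))"
    by (rule sum.reindex_bij_witness[where i = prod.swap and j = prod.swap])
       (auto simp: ordered_pairs_def)
  have "(\<Sum>(i, j)\<in>?T. \<Sum>l\<in>L. \<phi> l (X i w) * \<phi> l (X j w))
      = (\<Sum>t\<in>?T. mean_norm2 + lin (X (fst t) w) + lin (X (snd t) w) + degen (X (fst t) w) (X (snd t) w))"
    by (simp add: hoeffding_decomposition split_def)
  also have "\<dots> = real n * (real n - 1) * mean_norm2 + 2 * (real n - 1) * (\<Sum>i\<in>{1..n}. lin (X i w))
      + (\<Sum>t\<in>?T. degen (X (fst t) w) (X (snd t) w))"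
    using assms card_ordered_pairs[of n] by (simp add: sum.distrib fst snd)
  also have "\<dots> = real n * (real n - 1) * (mean_norm2 + 2 / real n * (\<Sum>i\<in>{1..n}. lin (X i w)))
      + (\<Sum>t\<in>?T. degen (X (fst t) w) (X (snd t) w))"
    using assms by (simp add: field_simps)
  finally show ?thesis
    unfolding offdiag_mean_def degen_mean_def
    by (simp only: add_divide_distrib nonzero_mult_div_cancel_left[OF c])
qed

lemma expectation_diag_mean:
  assumes "1 \<le> n"
  shows "integrable \<Omega> (\<lambda>w. diag_mean L \<phi> n (\<lambda>i. X i w))"
    and "expectation (\<lambda>w. diag_mean L \<phi> n (\<lambda>i. X i w)) = mean_norm2 + excess"
  using expectation_sum_of_centred[of diag_dev n] expectation_diag_dev
    sq_integrable_imp_integrable[OF sq_integrable_diag_dev]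
  by (simp_all add: diag_mean_decomposition[OF assms] prob_space)

lemma expectation_offdiag_mean:
  assumes "2 \<le> n"
  shows "integrable \<Omega> (\<lambda>w. offdiag_mean L \<phi> n (\<lambda>i. X i w))"
    and "expectation (\<lambda>w. offdiag_mean L \<phi> n (\<lambda>i. X i w)) = mean_norm2"
  using expectation_sum_of_centred[of lin n] expectation_lin
    sq_integrable_imp_integrable[OF sq_integrable_lin]
    sq_integrable_imp_integrable[OF sq_integrable_degen_mean[of n]] expectation_degen_mean[of n]
  by (simp_all add: offdiag_mean_decomposition[OF assms] prob_space)

lemma expectation_cross:
  assumes "1 \<le> i" "1 \<le> j" "i \<noteq> j"
  shows "expectation (cross X L \<phi> i j) = mean_norm2"
  unfolding cross_def[abs_def] hoeffding_decomposition
  using sq_integrable_imp_integrable[OF sq_integrable_lin] expectation_lin assms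
    sq_integrable_imp_integrable[OF sq_integrable_degen] expectation_degen
  by (simp add: prob_space)

lemma lin_orthogonal:
  assumes "1 \<le> i" "1 \<le> j" "i \<noteq> j"
    and f: "f \<in> borel_measurable unit_lebesgue" "sq_integrable \<Omega> (\<lambda>w. f (X i w))"
  shows "expectation (\<lambda>w. f (X i w) * lin (X j w)) = 0"
  using assms expectation_lin[OF assms(2)] sq_integrable_imp_integrable sq_integrable_lin[OF assms(2)]
  by (intro centred_single_orthogonal) auto

text \<open>Only the linear part of the kernel in the shared observation survives.\<close>

lemma cov_sq_sum_cross:
  "cov \<Omega> (sq_sum X L \<phi> 1) (cross X L \<phi> 1 3) = expectation (\<lambda>w. diag_dev (X 1 w) * lin (X 1 w))"
proof -
  have mean: "expectation (cross X L \<phi> 1 3) = mean_norm2"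
    by (rule expectation_cross) auto
  have "cov \<Omega> (sq_sum X L \<phi> 1) (cross X L \<phi> 1 3) =
      expectation (\<lambda>w. diag_dev (X 1 w) * lin (X 1 w) + diag_dev (X 1 w) * lin (X 3 w)
        + degen (X 1 w) (X 3 w) * diag_dev (X 1 w))"
    unfolding cov_def mean
    unfolding cross_def hoeffding_decomposition
    by (intro Bochner_Integration.integral_cong refl)
       (simp add: diag_dev_def sq_sum_def algebra_simps)
  then show ?thesis
    using lin_orthogonal[of 1 3 diag_dev] degen_orthogonal_to_single[of 1 3 1 diag_dev]
    by (simp add: sq_integrable_mult sq_integrable_diag_dev sq_integrable_lin sq_integrable_degen)
qed

text \<open>Of the nine products of Hoeffding components, only the one of the linear parts in the shared
  observation \<open>X 1\<close> can have a nonzero mean.\<close>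

lemma cov_cross_cross:
  "cov \<Omega> (cross X L \<phi> 1 2) (cross X L \<phi> 1 3) = expectation (\<lambda>w. (lin (X 1 w))\<^sup>2)"
proof -
  have mean: "expectation (cross X L \<phi> 1 2) = mean_norm2" "expectation (cross X L \<phi> 1 3) = mean_norm2"
    by (rule expectation_cross; auto)+
  have "cov \<Omega> (cross X L \<phi> 1 2) (cross X L \<phi> 1 3) =
      expectation (\<lambda>w. lin (X 1 w) * lin (X 1 w) + lin (X 1 w) * lin (X 3 w)
        + lin (X 1 w) * lin (X 2 w) + lin (X 2 w) * lin (X 3 w)
        + degen (X 1 w) (X 3 w) * lin (X 1 w) + degen (X 1 w) (X 3 w) * lin (X 2 w)
        + degen (X 1 w) (X 2 w) * lin (X 1 w) + degen (X 1 w) (X 2 w) * lin (X 3 w)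
        + degen (X 1 w) (X 2 w) * degen (X 1 w) (X 3 w))"
    unfolding cov_def mean
    unfolding cross_def hoeffding_decomposition
    by (intro Bochner_Integration.integral_cong refl) (simp add: algebra_simps)
  then show ?thesis
    using lin_orthogonal[of _ _ lin] degen_orthogonal_to_single[of _ _ _ lin]
      degen_orthogonal_to_degen[of 1 2 1 3]
    by (simp add: sq_integrable_mult sq_integrable_lin sq_integrable_degen power2_eq_square doubleton_eq_iff)
qed

lemma lpo_stat_decomposition:
  assumes "orthonormal_family L \<phi>" "p \<in> {1..n - 1}"
  defines "t \<equiv> 1 / real (n - p)"
  shows "lpo_stat X L \<phi> n p w = t * excess - mean_norm2
           + ((\<Sum>i\<in>{1..n}. risk_lin t (X i w)) / real n - (1 + t) * degen_mean n w)"
proof -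
  have n: "2 \<le> n" "1 \<le> n" using assms(2) by auto
  have sum: "(\<Sum>i\<in>{1..n}. risk_lin t (X i w)) =
      t * (\<Sum>i\<in>{1..n}. diag_dev (X i w)) - 2 * (1 + t) * (\<Sum>i\<in>{1..n}. lin (X i w))"
    unfolding sum_distrib_left sum_subtractf[symmetric]
    by (intro sum.cong refl) (simp add: risk_lin_def slope_def algebra_simps)
  show ?thesis
    unfolding lpo_stat_def lpo_risk_closed_form[OF finite_L assms(1,2)]
      diag_mean_decomposition[OF n(2)] offdiag_mean_decomposition[OF n(1)] t_def[symmetric] sum
    by (simp add: algebra_simps diff_divide_distrib add_divide_distrib)
qed

lemma expectation_lpo_stat:
  assumes "orthonormal_family L \<phi>" "p \<in> {1..n - 1}"
  shows "expectation (lpo_stat X L \<phi> n p) = 1 / real (n - p) * excess - mean_norm2"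
proof -
  let ?t = "1 / real (n - p)"
  show ?thesis
    using expectation_sum_of_centred[of "risk_lin ?t" n] expectation_risk_lin
      sq_integrable_imp_integrable[OF sq_integrable_risk_lin]
      sq_integrable_imp_integrable[OF sq_integrable_degen_mean[of n]] expectation_degen_mean[of n]
    unfolding lpo_stat_decomposition[OF assms, abs_def]
    by (simp add: prob_space)
qed

text \<open>The linear and the degenerate part are uncorrelated, so their second moments add up.\<close>

lemma var_lpo_stat:
  assumes "orthonormal_family L \<phi>" "p \<in> {1..n - 1}"
  defines "t \<equiv> 1 / real (n - p)"
  shows "var \<Omega> (lpo_stat X L \<phi> n p) =
           expectation (\<lambda>w. (risk_lin t (X 1 w))\<^sup>2) / real n
           + (1 + t)\<^sup>2 * (2 * degen_norm2 / (real n * (real n - 1)))"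
proof -
  have n: "1 \<le> n" "2 \<le> n" using assms(2) by auto
  let ?T = "ordered_pairs n" and ?c = "real n * (real n - 1)"
  have c: "?c \<noteq> 0" using n by auto
  let ?V = "\<lambda>w. \<Sum>i\<in>{1..n}. risk_lin t (X i w)"
  let ?D = "\<lambda>w. \<Sum>u\<in>?T. degen (X (fst u) w) (X (snd u) w)"
  have V: "sq_integrable \<Omega> ?V"
    by (intro sq_integrable_sum sq_integrable_risk_lin) auto
  have D: "sq_integrable \<Omega> ?D"
    by (intro sq_integrable_sum sq_integrable_degen) (auto simp: ordered_pairs_def)
  have VD: "expectation (\<lambda>w. ?D w * ?V w) = 0"
  proof -
    have "expectation (\<lambda>w. ?D w * ?V w) =
       (\<Sum>u\<in>?T. \<Sum>i\<in>{1..n}. expectation (\<lambda>w. degen (X (fst u) w) (X (snd u) w) * risk_lin t (X i w)))"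
      by (rule integral_sum_mult_sum)
         (auto intro!: sq_integrable_degen sq_integrable_risk_lin simp: ordered_pairs_def)
    also have "\<dots> = 0"
      using degen_orthogonal_to_single[OF _ _ _ _ risk_lin_measurable sq_integrable_risk_lin]
      by (intro sum.neutral ballI) (auto simp: ordered_pairs_def)
    finally show ?thesis .
  qed
  have "var \<Omega> (lpo_stat X L \<phi> n p) =
      expectation (\<lambda>w. (?V w / real n - (1 + t) * degen_mean n w)\<^sup>2)"
    unfolding var_def expectation_lpo_stat[OF assms(1,2)] lpo_stat_decomposition[OF assms(1,2)] t_def
    by simp
  also have "\<dots> = expectation (\<lambda>w. (1 / real n)\<^sup>2 * (?V w)\<^sup>2
        - 2 * (1 + t) / (real n * ?c) * (?D w * ?V w) + ((1 + t) / ?c)\<^sup>2 * (?D w)\<^sup>2)"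
    unfolding degen_mean_def
    by (intro Bochner_Integration.integral_cong refl)
       (simp add: power2_diff power_divide power_mult_distrib mult_ac)
  also have "\<dots> = (1 / real n)\<^sup>2 * expectation (\<lambda>w. (?V w)\<^sup>2)
       - 2 * (1 + t) / (real n * ?c) * expectation (\<lambda>w. ?D w * ?V w)
       + ((1 + t) / ?c)\<^sup>2 * expectation (\<lambda>w. (?D w)\<^sup>2)"
    using V D sq_integrable_mult[OF D V] unfolding sq_integrable_def
    by (subst Bochner_Integration.integral_add Bochner_Integration.integral_diff, simp, simp)+ simp
  also have "\<dots> = (1 / real n)\<^sup>2 * (real n * expectation (\<lambda>w. (risk_lin t (X 1 w))\<^sup>2))
       + ((1 + t) / ?c)\<^sup>2 * (2 * ?c * degen_norm2)"
    unfolding VD expectation_sum_degen_square[OF n(1)]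
      expectation_sum_singles_square[OF risk_lin_measurable sq_integrable_risk_lin[OF order.refl]
        expectation_risk_lin[OF order.refl]]
    by simp
  also have "\<dots> = expectation (\<lambda>w. (risk_lin t (X 1 w))\<^sup>2) / real n
           + (1 + t)\<^sup>2 * (2 * degen_norm2 / ?c)"
    using c by (simp add: power2_eq_square)
  finally show ?thesis .
qed

text \<open>Expanding the square around \<open>- 2 * lin\<close>: the mixed moment of \<open>slope\<close> and \<open>lin\<close> is the
  difference of the two covariances that are compared in the covariance condition.\<close>

lemma expectation_risk_lin_square:
  "expectation (\<lambda>w. (risk_lin t (X 1 w))\<^sup>2) =
     t\<^sup>2 * expectation (\<lambda>w. (slope (X 1 w))\<^sup>2)
     + 4 * t * (2 * cov \<Omega> (cross X L \<phi> 1 2) (cross X L \<phi> 1 3)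
                 - cov \<Omega> (sq_sum X L \<phi> 1) (cross X L \<phi> 1 3))
     + 4 * cov \<Omega> (cross X L \<phi> 1 2) (cross X L \<phi> 1 3)"
proof -
  note sq = sq_integrable_slope[OF order.refl] sq_integrable_lin[OF order.refl]
    sq_integrable_diag_dev[OF order.refl]
  have "expectation (\<lambda>w. (risk_lin t (X 1 w))\<^sup>2) =
    expectation (\<lambda>w. t\<^sup>2 * (slope (X 1 w))\<^sup>2 + (8 * t + 4) * (lin (X 1 w))\<^sup>2
        - 4 * t * (diag_dev (X 1 w) * lin (X 1 w)))"
    by (intro Bochner_Integration.integral_cong refl)
       (simp add: risk_lin_def slope_def power2_eq_square algebra_simps)
  also have "\<dots> = t\<^sup>2 * expectation (\<lambda>w. (slope (X 1 w))\<^sup>2)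
      + (8 * t + 4) * expectation (\<lambda>w. (lin (X 1 w))\<^sup>2)
      - 4 * t * expectation (\<lambda>w. diag_dev (X 1 w) * lin (X 1 w))"
    using sq sq_integrable_mult[OF sq(3,2)] unfolding sq_integrable_def by simp
  finally show ?thesis
    unfolding cov_cross_cross cov_sq_sum_cross by (simp add: algebra_simps)
qed

text \<open>The expected loss at sample size \<open>n\<close> is \<open>excess / n - mean_norm2\<close>. The risk estimator has the
  expectation that belongs to the training sample size \<open>n - p\<close>, and the bias is the difference.\<close>

lemma lpo_bias_formula:
  assumes "orthonormal_family L \<phi>" "L2_unit s" "p \<in> {1..n - 1}"
  shows "lpo_bias \<Omega> X s L \<phi> n p = (1 / real (n - p) - 1 / real n) * excess"
proof -
  have n: "1 \<le> n" "2 \<le> n" using assms(3) by auto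
  let ?S = "\<lambda>w. \<Sum>i\<in>{1..n}. \<Sum>l\<in>L. L2_inner s (\<phi> l) * \<phi> l (X i w)"
  have inner: "L2_inner s (\<phi> l) = mean_coef l" if "l \<in> L" for l
    unfolding L2_inner_def mean_coef_def by (rule expectation_density[OF basis_measurable[OF that]]) simp
  have S: "?S w = real n * mean_norm2 + (\<Sum>i\<in>{1..n}. lin (X i w))" for w
    unfolding mean_norm2_def lin_def dev_def
    by (simp add: inner right_diff_distrib sum_subtractf power2_eq_square)
  have lin: "integrable \<Omega> (\<lambda>w. \<Sum>i\<in>{1..n}. lin (X i w))" "expectation (\<lambda>w. \<Sum>i\<in>{1..n}. lin (X i w)) = 0"
    using expectation_sum_of_centred[of lin n] expectation_lin
      sq_integrable_imp_integrable[OF sq_integrable_lin] by simp_all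
  have "expectation (est_loss X s L \<phi> n) =
      ((mean_norm2 + excess) + (real n - 1) * mean_norm2) / real n - 2 / real n * (real n * mean_norm2)"
    unfolding est_loss_closed_form[OF finite_L assms(1,2) n(2), abs_def] S
    using lin expectation_diag_mean[OF n(1)] expectation_offdiag_mean[OF n(2)]
    by (simp add: prob_space)
  also have "\<dots> = excess / real n - mean_norm2"
    using n by (simp add: field_simps)
  finally show ?thesis
    unfolding lpo_bias_def expectation_lpo_stat[OF assms(1,3)] by (simp add: algebra_simps)
qed

lemma degen_norm2_nonneg: "0 \<le> degen_norm2"
  unfolding degen_norm2_def by (intro sum_nonneg zero_le_power2)

section \<open>The mean squared error\<close>

text \<open>The first summand is the leading one and is free of \<open>p\<close>. In the
  others only the coefficient \<open>2 * C - K\<close> can be negative, and the covariance condition is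
  exactly that it is not.\<close>

lemma lpo_MSE_formula:
  assumes "orthonormal_family L \<phi>" "L2_unit s" "p \<in> {1..n - 1}"
  defines "t \<equiv> 1 / real (n - p)"
    and "C \<equiv> cov \<Omega> (cross X L \<phi> 1 2) (cross X L \<phi> 1 3)"
    and "K \<equiv> cov \<Omega> (sq_sum X L \<phi> 1) (cross X L \<phi> 1 3)"
  shows "lpo_MSE \<Omega> X s L \<phi> n p =
           4 * C / real n + (t - 1 / real n)\<^sup>2 * excess\<^sup>2
           + (t\<^sup>2 * expectation (\<lambda>w. (slope (X 1 w))\<^sup>2) + 4 * t * (2 * C - K)) / real n
           + (1 + t)\<^sup>2 * (2 * degen_norm2 / (real n * (real n - 1)))"
  unfolding lpo_MSE_def lpo_bias_formula[OF assms(1-3)] var_lpo_stat[OF assms(1,3)]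
    expectation_risk_lin_square C_def[symmetric] K_def[symmetric] t_def[symmetric]
  by (simp add: power_mult_distrib add_divide_distrib)

text \<open>Every summand of the formula is nondecreasing in \<open>1 / (n - p)\<close>: the bias term because
  \<open>1 / (n - p) \<ge> 1 / n\<close>, and the linear term because the covariance condition makes its
  coefficient nonnegative.\<close>

lemma lpo_MSE_minimal_at_1:
  assumes "orthonormal_family L \<phi>" "L2_unit s" "p \<in> {1..n - 1}" "cov_condition \<Omega> X L \<phi>"
  shows "lpo_MSE \<Omega> X s L \<phi> n 1 \<le> lpo_MSE \<Omega> X s L \<phi> n p"
proof -
  have n: "2 \<le> n" and p1: "(1::nat) \<in> {1..n - 1}" using assms(3) by auto
  define a where "a = 1 / real (n - 1)"
  define b where "b = 1 / real (n - p)"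
  have ab: "1 / real n \<le> a" "a \<le> b" "0 \<le> a"
    using n assms(3) unfolding a_def b_def by (auto intro!: divide_left_mono)
  have "(a - 1 / real n)\<^sup>2 \<le> (b - 1 / real n)\<^sup>2" "a\<^sup>2 \<le> b\<^sup>2" "(1 + a)\<^sup>2 \<le> (1 + b)\<^sup>2"
    using ab by (auto intro!: power_mono)
  then show ?thesis
    unfolding lpo_MSE_formula[OF assms(1,2) p1] lpo_MSE_formula[OF assms(1-3)]
      a_def[symmetric] b_def[symmetric]
    using ab assms(4) degen_norm2_nonneg n
    by (intro add_mono mult_right_mono divide_right_mono mult_left_mono order.refl)
       (auto simp: cov_condition_def)
qed

text \<open>If \<open>p n / n < c < 1\<close> eventually, then \<open>t = 1 / (n - p n) \<le> D / n\<close> with \<open>D = 1 / (1 - c)\<close>, and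
  each summand other than the leading one is bounded by a multiple of \<open>1 / n\<^sup>2\<close>.\<close>

lemma lpo_MSE_expansion:
  assumes "orthonormal_family L \<phi>" "L2_unit s"
    and p: "\<And>n. 2 \<le> n \<Longrightarrow> p n \<in> {1..n - 1}"
    and limsup: "limsup (\<lambda>n. ereal (real (p n) / real n)) < 1"
  shows "(\<lambda>n. lpo_MSE \<Omega> X s L \<phi> n (p n)
           - 4 * cov \<Omega> (cross X L \<phi> 1 2) (cross X L \<phi> 1 3) / real n) \<in> O(\<lambda>n. 1 / (real n)\<^sup>2)"
proof -
  define C where "C = cov \<Omega> (cross X L \<phi> 1 2) (cross X L \<phi> 1 3)"
  define K where "K = cov \<Omega> (sq_sum X L \<phi> 1) (cross X L \<phi> 1 3)"
  define Q where "Q = expectation (\<lambda>w. (slope (X 1 w))\<^sup>2)"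
  have Q: "0 \<le> Q" unfolding Q_def by simp
  obtain c where c: "limsup (\<lambda>n. ereal (real (p n) / real n)) < ereal c" "ereal c < 1"
    using ereal_dense2[OF limsup] by auto
  then have c1: "c < 1" by simp
  define D where "D = 1 / (1 - c)"
  have D: "0 < D" using c1 by (simp add: D_def)
  have ev: "\<forall>\<^sub>F n in sequentially. ereal (real (p n) / real n) < ereal c"
    by (rule Limsup_lessD[OF c(1)])
  define B where "B = D\<^sup>2 * excess\<^sup>2 + D\<^sup>2 * Q + 4 * D * \<bar>2 * C - K\<bar> + 16 * degen_norm2"
  show ?thesis
    unfolding C_def[symmetric]
  proof (rule bigoI[where c = B])
    show "\<forall>\<^sub>F n in sequentially. norm (lpo_MSE \<Omega> X s L \<phi> n (p n) - 4 * C / real n) \<le> B * norm (1 / (real n)\<^sup>2)"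
      using ev eventually_ge_at_top[of 2]
    proof eventually_elim
      case (elim n)
      have n: "0 < real n" "2 \<le> real n" and pn: "p n \<in> {1..n - 1}" "p n < n"
        using p[OF elim(2)] elim(2) by auto
      define t where "t = 1 / real (n - p n)"
      have t1: "1 / real n \<le> t" "t \<le> 1"
        using pn elim(2) unfolding t_def by (auto intro!: divide_left_mono)
      have t0: "0 \<le> t" by (simp add: t_def)
      have tD: "t \<le> D / real n"
      proof -
        have "real (p n) < c * real n" using elim(1) n by (simp add: divide_less_eq)
        then have "(1 - c) * real n \<le> real (n - p n)"
          using pn by (simp add: of_nat_diff algebra_simps)
        then have "t \<le> 1 / ((1 - c) * real n)"
          unfolding t_def using c1 n by (intro divide_left_mono mult_pos_pos) (use pn(2) in auto)
        then show ?thesis by (simp add: D_def)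
      qed
      have t2: "t\<^sup>2 \<le> D\<^sup>2 / (real n)\<^sup>2"
        using power_mono[OF tD t0, of 2] by (simp add: power_divide)
      have e1: "\<bar>(t - 1 / real n)\<^sup>2 * excess\<^sup>2\<bar> \<le> D\<^sup>2 / (real n)\<^sup>2 * excess\<^sup>2"
      proof -
        have "(t - 1 / real n)\<^sup>2 \<le> t\<^sup>2"
          using t1 t0 n by (intro power_mono) auto
        then have "(t - 1 / real n)\<^sup>2 * excess\<^sup>2 \<le> D\<^sup>2 / (real n)\<^sup>2 * excess\<^sup>2"
          using t2 by (intro mult_right_mono) auto
        then show ?thesis by (simp add: abs_mult)
      qed
      have e2: "\<bar>t\<^sup>2 * Q / real n\<bar> \<le> D\<^sup>2 / (real n)\<^sup>2 * Q"
      proof -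
        have "t\<^sup>2 * Q / real n \<le> t\<^sup>2 * Q / 1"
          using n Q by (intro divide_left_mono) auto
        also have "\<dots> \<le> D\<^sup>2 / (real n)\<^sup>2 * Q"
          using mult_right_mono[OF t2 Q] by simp
        finally show ?thesis using Q by (simp add: abs_mult)
      qed
      have e3: "\<bar>4 * t * (2 * C - K) / real n\<bar> \<le> 4 * (D / real n) * \<bar>2 * C - K\<bar> / real n"
      proof -
        have "4 * t * \<bar>2 * C - K\<bar> / real n \<le> 4 * (D / real n) * \<bar>2 * C - K\<bar> / real n"
          using tD n by (intro divide_right_mono mult_right_mono mult_left_mono) auto
        then show ?thesis using t0 by (simp add: abs_mult)
      qed
      have e4: "\<bar>(1 + t)\<^sup>2 * (2 * degen_norm2 / (real n * (real n - 1)))\<bar> \<le> 16 * degen_norm2 / (real n)\<^sup>2"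
      proof -
        have a: "(1 + t)\<^sup>2 \<le> 2\<^sup>2" using t1 t0 by (intro power_mono) auto
        \<comment> \<open>Equivalent to \<open>2 \<le> n\<close>; it makes \<open>1 / (n * (n - 1))\<close> comparable to \<open>1 / n\<^sup>2\<close>.\<close>
        have "(real n)\<^sup>2 / 2 \<le> real n * (real n - 1)"
          using n by (simp add: power2_eq_square)
        then have "2 * degen_norm2 / (real n * (real n - 1)) \<le> 2 * degen_norm2 / ((real n)\<^sup>2 / 2)"
          using n degen_norm2_nonneg by (intro divide_left_mono) auto
        moreover have "0 \<le> 2 * degen_norm2 / (real n * (real n - 1))"
          using n degen_norm2_nonneg by simp
        ultimately have "(1 + t)\<^sup>2 * (2 * degen_norm2 / (real n * (real n - 1)))
            \<le> 2\<^sup>2 * (2 * degen_norm2 / ((real n)\<^sup>2 / 2))"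
          using a by (intro mult_mono) auto
        then show ?thesis using n degen_norm2_nonneg by (simp add: abs_mult)
      qed
      have "lpo_MSE \<Omega> X s L \<phi> n (p n) - 4 * C / real n = (t - 1 / real n)\<^sup>2 * excess\<^sup>2
          + t\<^sup>2 * Q / real n + 4 * t * (2 * C - K) / real n
           + (1 + t)\<^sup>2 * (2 * degen_norm2 / (real n * (real n - 1)))"
        unfolding lpo_MSE_formula[OF assms(1,2) pn(1)] t_def[symmetric] C_def[symmetric]
          K_def[symmetric] Q_def[symmetric] by (simp add: add_divide_distrib)
      then have "\<bar>lpo_MSE \<Omega> X s L \<phi> n (p n) - 4 * C / real n\<bar> \<le> D\<^sup>2 / (real n)\<^sup>2 * excess\<^sup>2
          + D\<^sup>2 / (real n)\<^sup>2 * Q + 4 * (D / real n) * \<bar>2 * C - K\<bar> / real n + 16 * degen_norm2 / (real n)\<^sup>2"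
        using abs_add_four_le[OF e1 e2 e3 e4] by (simp only:)
      also have "\<dots> = B * norm (1 / (real n)\<^sup>2)"
        unfolding B_def using n by (simp add: power2_eq_square add_divide_distrib distrib_right)
      finally show ?case by simp
    qed
  qed
qed

end

context iid_sample
begin

text \<open>For \<open>n = 3\<close> the risk estimators for \<open>p = 1\<close> and \<open>p = 2\<close> are \<open>G / 2 - 3 * H / 2\<close> and
  \<open>G - 2 * H\<close>, where \<open>G\<close> and \<open>H\<close> are the diagonal and off-diagonal means. Eliminating \<open>H\<close>
  leaves \<open>G\<close>, an average of nonnegative terms, which controls each of them.\<close>

lemma fourth_moment_from_lpo_variances:
  assumes L: "finite L" "orthonormal_family L \<phi>"
    and var: "has_var \<Omega> (lpo_stat X L \<phi> 3 1)" "has_var \<Omega> (lpo_stat X L \<phi> 3 2)"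
  shows "sq_integrable \<Omega> (sq_sum X L \<phi> 1)"
proof (rule sq_integrable_dominated)
  \<comment> \<open>The combination that eliminates the off-diagonal mean, scaled by the sample size 3.\<close>
  let ?R = "\<lambda>w. 3 * (3 * lpo_stat X L \<phi> 3 2 w - 4 * lpo_stat X L \<phi> 3 1 w)"
  show "sq_integrable \<Omega> ?R"
    using var by (intro sq_integrable_cmult sq_integrable_diff has_var_imp_sq_integrable)
  have "\<phi> l \<in> borel_measurable unit_lebesgue" if "l \<in> L" for l
    using L(2) that by (auto simp: orthonormal_family_def L2_unit_def)
  then show "sq_sum X L \<phi> 1 \<in> borel_measurable \<Omega>"
    unfolding sq_sum_def[abs_def] using X_measurable[of 1] by measurable
  show "\<bar>sq_sum X L \<phi> 1 w\<bar> \<le> \<bar>?R w\<bar>" for w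
  proof -
    have "?R w = 3 * diag_mean L \<phi> 3 (\<lambda>i. X i w)"
      unfolding lpo_stat_def by (simp add: lpo_risk_closed_form[OF L] field_simps)
    also have "\<dots> = (\<Sum>i\<in>{1..3}. sq_sum X L \<phi> i w)"
      by (simp add: diag_mean_def sq_sum_def)
    finally have "?R w = (\<Sum>i\<in>{1..3}. sq_sum X L \<phi> i w)" .
    moreover have "sq_sum X L \<phi> 1 w \<le> (\<Sum>i\<in>{1..3}. sq_sum X L \<phi> i w)"
      by (rule member_le_sum) (auto simp: sq_sum_def sum_nonneg)
    moreover have "0 \<le> sq_sum X L \<phi> 1 w"
      by (simp add: sq_sum_def sum_nonneg)
    ultimately show ?thesis by simp
  qed
qed

end

theorem theorem2p1:
  fixes \<Omega> :: "'a measure"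
    and X :: "nat \<Rightarrow> 'a \<Rightarrow> real"
    and s :: "real \<Rightarrow> real"
    and M :: "nat \<Rightarrow> 'm set"
    and \<Lambda> :: "'m \<Rightarrow> 'l set"
    and \<phi> :: "'l \<Rightarrow> real \<Rightarrow> real"
  assumes "prob_space \<Omega>"
    and "L2_unit s"
    and "\<And>x. x \<in> {0..1} \<Longrightarrow> 0 \<le> s x"
    and "\<And>i. 1 \<le> i \<Longrightarrow> distributed \<Omega> unit_lebesgue (X i) (\<lambda>x. ennreal (s x))"
    and "prob_space.indep_vars \<Omega> (\<lambda>_. unit_lebesgue) X {1..}"
    and "\<And>n. countable (M n)"
    and "\<And>m. m \<in> (\<Union>n. M n) \<Longrightarrow> finite (\<Lambda> m)"
    and "\<And>m. m \<in> (\<Union>n. M n) \<Longrightarrow> orthonormal_family (\<Lambda> m) \<phi>"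
    and "\<And>m n p. m \<in> (\<Union>n. M n) \<Longrightarrow> p \<in> {1..n - 1} \<Longrightarrow> has_var \<Omega> (lpo_stat X (\<Lambda> m) \<phi> n p)"
    and "\<And>m n. m \<in> (\<Union>n. M n) \<Longrightarrow> 2 \<le> n \<Longrightarrow> integrable \<Omega> (est_loss X s (\<Lambda> m) \<phi> n)"
    and "\<And>m. m \<in> (\<Union>n. M n) \<Longrightarrow> has_cov \<Omega> (cross X (\<Lambda> m) \<phi> 1 2) (cross X (\<Lambda> m) \<phi> 1 3)"
    and "\<And>m. m \<in> (\<Union>n. M n) \<Longrightarrow> has_cov \<Omega> (sq_sum X (\<Lambda> m) \<phi> 1) (cross X (\<Lambda> m) \<phi> 1 3)"
  shows "(\<forall>n. \<forall>m\<in>M n. cov_condition \<Omega> X (\<Lambda> m) \<phi> \<longrightarrow>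
            (\<forall>p\<in>{1..n - 1}. lpo_MSE \<Omega> X s (\<Lambda> m) \<phi> n 1 \<le> lpo_MSE \<Omega> X s (\<Lambda> m) \<phi> n p)) \<and>
         (\<forall>m\<in>(\<Union>n. M n). \<not> cov_condition \<Omega> X (\<Lambda> m) \<phi> \<longrightarrow>
            (\<forall>p :: nat \<Rightarrow> nat.
               (\<forall>n\<ge>2. p n \<in> {1..n - 1}) \<longrightarrow>
               limsup (\<lambda>n. ereal (real (p n) / real n)) < 1 \<longrightarrow>
               (\<lambda>n. lpo_MSE \<Omega> X s (\<Lambda> m) \<phi> n (p n)
                      - 4 * cov \<Omega> (cross X (\<Lambda> m) \<phi> 1 2) (cross X (\<Lambda> m) \<phi> 1 3) / real n)
                 \<in> O(\<lambda>n. 1 / (real n)\<^sup>2)))"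
proof -
  interpret prob_space \<Omega> by (fact assms(1))
  interpret iid_sample \<Omega> X s
    using assms(3-5) by unfold_locales auto
  have moments: "projection_moments \<Omega> X s (\<Lambda> m) \<phi>" if m: "m \<in> (\<Union>n. M n)" for m
  proof
    show "finite (\<Lambda> m)" by (fact assms(7)[OF m])
    show "\<phi> l \<in> borel_measurable unit_lebesgue" if "l \<in> \<Lambda> m" for l
      using assms(8)[OF m] that by (auto simp: orthonormal_family_def L2_unit_def)
    show "sq_integrable \<Omega> (sq_sum X (\<Lambda> m) \<phi> 1)"
      by (rule fourth_moment_from_lpo_variances[OF assms(7,8)[OF m]]) (rule assms(9)[OF m], simp)+
  qed
  show ?thesis
  proof (intro conjI allI ballI impI)
    fix n m p
    assume "m \<in> M n" "cov_condition \<Omega> X (\<Lambda> m) \<phi>" "p \<in> {1..n - 1}"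
    then show "lpo_MSE \<Omega> X s (\<Lambda> m) \<phi> n 1 \<le> lpo_MSE \<Omega> X s (\<Lambda> m) \<phi> n p"
      using projection_moments.lpo_MSE_minimal_at_1[OF moments assms(8) assms(2)] by blast
  next
    fix m and p :: "nat \<Rightarrow> nat"
    assume m: "m \<in> (\<Union>n. M n)" and p: "\<forall>n\<ge>2. p n \<in> {1..n - 1}"
      and limsup: "limsup (\<lambda>n. ereal (real (p n) / real n)) < 1"
    show "(\<lambda>n. lpo_MSE \<Omega> X s (\<Lambda> m) \<phi> n (p n)
             - 4 * cov \<Omega> (cross X (\<Lambda> m) \<phi> 1 2) (cross X (\<Lambda> m) \<phi> 1 3) / real n)
            \<in> O(\<lambda>n. 1 / (real n)\<^sup>2)"
      using projection_moments.lpo_MSE_expansion[OF moments[OF m] assms(8)[OF m] assms(2) _ limsup] p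
      by blast
  qed
qed

end
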